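(* Let $M>0$. For any $r>0$, set $d:=d(n)=\lfloor n^r\rfloor$, and let $0<\alpha\le 0.2$. Then there exist a distribution over $(X,Y)\in[0,1]^d\times[-M,M]$ (for each $n$) and a sequence $k=k(n)$ such that: $X$ has a density $f$ on $[0,1]^d$ with $\zeta^{-1}\le f(x)\le\zeta$ for all $x$, for some constant $\zeta\ge1$; $$\lim_{n\to\infty}\frac{\log(n)\,\max\{\log(d),\,\log\log(n)\}}{k}=0;$$ and, for $n$ i.i.d. training examples $(X_i,Y_i)$ from this distribution, $$\lim_{n\to\infty}\mathbb{P}\left[\sup_{x\in[0,1]^d,\ \Lambda\in\mathcal{V}_{\alpha,k}}\left|T_\Lambda(x)-T^*_\Lambda(x)\right|\ge\frac{M}{5}\sqrt{\frac{\log(n)\log(d)}{k}}\right]=1.$$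
   Context: Recursive partitioning: starting from the root node $\nu=[0,1]^d$, repeatedly select a currently unsplit node $\nu$, a splitting variable $j\in\{1,\dots,d\}$ and a threshold $\tau\in[0,1]$, and split $\nu$ into two children $\nu_-=\nu\cap\{x:x_j\le\tau\}$ and $\nu_+=\nu\cap\{x:x_j>\tau\}$. The final unsplit nodes (leaves, or terminal nodes) form a partition $\Lambda$ of $[0,1]^d$; $L(x)$ denotes the unique element of $\Lambda$ containing $x$. A partition $\Lambda$ is $\{\alpha,k\}$-valid if it can be generated by a recursive partitioning scheme in which each child node contains at least a fraction $\alpha$ of the data points $X_i$ in its parent node, and each terminal node contains at least $k$ training examples. $\mathcal{V}_{\alpha,k}$ is the (data-dependent) set of $\{\alpha,k\}$-valid partitions. For $\Lambda\in\mathcal{V}_{\alpha,k}$ the valid tree is $T_\Lambda(x)=\frac{1}{|\{i:X_i\in L(x)\}|}\sum_{\{i:X_i\in L(x)\}}Y_i$, and the partition-optimal tree is $T^*_\Lambda(x)=\mathbb{E}[Y\mid X\in L(x)]$, where $(X,Y)$ is a new independent sample from the data-generating distribution (so the leaf is treated as fixed). *)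

theory Defs
  imports "HOL-Probability.Probability"
begin

text \<open>
  Points of $[0,1]^d$ are extensional functions on the coordinates \<open>{..<d}\<close>, so that the
  dimension may vary with the sample size. A data set is a function from the indices \<open>{..<n}\<close>
  to pairs \<open>(X, Y)\<close>.
\<close>

definition unit_cube :: "nat \<Rightarrow> (nat \<Rightarrow> real) set" where
  "unit_cube d = {..<d} \<rightarrow>\<^sub>E {0..1}"

text \<open>Lebesgue measure on $[0,1]^d$; its space is \<^term>\<open>unit_cube d\<close>.\<close>

definition cube_measure :: "nat \<Rightarrow> (nat \<Rightarrow> real) measure" where
  "cube_measure d = (\<Pi>\<^sub>M j\<in>{..<d}. restrict_space lborel {0..1})"

lemma space_cube_measure: "space (cube_measure d) = unit_cube d"
  by (simp add: cube_measure_def unit_cube_def space_PiM space_restrict_space)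

definition data_in :: "nat \<Rightarrow> (nat \<Rightarrow> (nat \<Rightarrow> real) \<times> real) \<Rightarrow> (nat \<Rightarrow> real) set \<Rightarrow> nat set" where
  "data_in n S \<nu> = {i. i < n \<and> fst (S i) \<in> \<nu>}"

inductive_set recursive_partitions ::
    "nat \<Rightarrow> real \<Rightarrow> nat \<Rightarrow> (nat \<Rightarrow> (nat \<Rightarrow> real) \<times> real) \<Rightarrow> (nat \<Rightarrow> real) set set set"
  for d :: nat and \<alpha> :: real and n :: nat and S :: "nat \<Rightarrow> (nat \<Rightarrow> real) \<times> real" where
  root: "{unit_cube d} \<in> recursive_partitions d \<alpha> n S"
| split:
    "\<lbrakk> \<Lambda> \<in> recursive_partitions d \<alpha> n S; \<nu> \<in> \<Lambda>; j < d; 0 \<le> \<tau>; \<tau> \<le> 1;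
       \<nu>\<^sub>l = \<nu> \<inter> {x. x j \<le> \<tau>}; \<nu>\<^sub>r = \<nu> \<inter> {x. x j > \<tau>};
       real (card (data_in n S \<nu>\<^sub>l)) \<ge> \<alpha> * real (card (data_in n S \<nu>));
       real (card (data_in n S \<nu>\<^sub>r)) \<ge> \<alpha> * real (card (data_in n S \<nu>)) \<rbrakk>
     \<Longrightarrow> (\<Lambda> - {\<nu>}) \<union> {\<nu>\<^sub>l, \<nu>\<^sub>r} \<in> recursive_partitions d \<alpha> n S"

definition valid_partitions ::
    "nat \<Rightarrow> real \<Rightarrow> nat \<Rightarrow> nat \<Rightarrow> (nat \<Rightarrow> (nat \<Rightarrow> real) \<times> real) \<Rightarrow> (nat \<Rightarrow> real) set set set" where
  "valid_partitions d \<alpha> k n S =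
     {\<Lambda> \<in> recursive_partitions d \<alpha> n S. \<forall>\<nu>\<in>\<Lambda>. card (data_in n S \<nu>) \<ge> k}"

definition leaf :: "(nat \<Rightarrow> real) set set \<Rightarrow> (nat \<Rightarrow> real) \<Rightarrow> (nat \<Rightarrow> real) set" where
  "leaf \<Lambda> x = (THE \<nu>. \<nu> \<in> \<Lambda> \<and> x \<in> \<nu>)"

lemma leaf_unique:
  assumes "\<Lambda> \<in> recursive_partitions d \<alpha> n S" and "x \<in> unit_cube d"
  shows "\<exists>!\<nu>. \<nu> \<in> \<Lambda> \<and> x \<in> \<nu>"
  using assms(1)
proof induction
  case root
  then show ?case using assms(2) by auto
next
  case (split \<Lambda> \<nu> j \<tau> \<nu>\<^sub>l \<nu>\<^sub>r)
  then have ex1: "\<exists>!\<nu>. \<nu> \<in> \<Lambda> \<and> x \<in> \<nu>" by simp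
  then obtain \<mu> where \<mu>: "\<mu> \<in> \<Lambda>" "x \<in> \<mu>" and uniq: "\<And>\<mu>'. \<mu>' \<in> \<Lambda> \<Longrightarrow> x \<in> \<mu>' \<Longrightarrow> \<mu>' = \<mu>"
    by (elim ex1E) metis
  show ?case
  proof (rule ex1I[of _ "if \<mu> = \<nu> then if x j \<le> \<tau> then \<nu>\<^sub>l else \<nu>\<^sub>r else \<mu>"], goal_cases)
    case 1
    show ?case using \<mu> split.hyps(6,7) by auto
  next
    case (2 \<rho>)
    have "\<rho> = \<mu>" if "\<rho> \<in> \<Lambda>"
      using 2 that by (intro uniq) simp_all
    moreover have "\<nu> = \<mu>" if "\<rho> = \<nu>\<^sub>l \<or> \<rho> = \<nu>\<^sub>r"
      using 2 that split.hyps(6,7) by (intro uniq \<open>\<nu> \<in> \<Lambda>\<close>) auto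
    ultimately show ?case using 2 split.hyps(6,7) by auto
  qed
qed

definition valid_tree ::
    "nat \<Rightarrow> (nat \<Rightarrow> (nat \<Rightarrow> real) \<times> real) \<Rightarrow> (nat \<Rightarrow> real) set set \<Rightarrow> (nat \<Rightarrow> real) \<Rightarrow> real" where
  "valid_tree n S \<Lambda> x =
     (\<Sum>i\<in>data_in n S (leaf \<Lambda> x). snd (S i)) / real (card (data_in n S (leaf \<Lambda> x)))"

text \<open>
  Elementary conditional expectation $E[Y \mid X \in L]$ for \<open>(X, Y)\<close> distributed as \<open>D\<close>. If $X$
  has a density bounded below, a nonempty leaf of probability zero arises only through a split at
  threshold $0$ and almost surely contains no data; such a leaf gets the value $0$.
\<close>

definition cond_mean ::
    "((nat \<Rightarrow> real) \<times> real) measure \<Rightarrow> (nat \<Rightarrow> real) set \<Rightarrow> real" where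
  "cond_mean D L =
     (LINT z:{z \<in> space D. fst z \<in> L}|D. snd z) / \<P>(z in D. fst z \<in> L)"

definition optimal_tree ::
    "((nat \<Rightarrow> real) \<times> real) measure \<Rightarrow> (nat \<Rightarrow> real) set set \<Rightarrow> (nat \<Rightarrow> real) \<Rightarrow> real" where
  "optimal_tree D \<Lambda> x = cond_mean D (leaf \<Lambda> x)"

text \<open>
  The supremum is taken in \<^typ>\<open>ereal\<close>: if there is no valid partition, it is $-\infty$.
\<close>

definition max_deviation ::
    "((nat \<Rightarrow> real) \<times> real) measure \<Rightarrow> nat \<Rightarrow> real \<Rightarrow> nat \<Rightarrow> nat \<Rightarrow>
     (nat \<Rightarrow> (nat \<Rightarrow> real) \<times> real) \<Rightarrow> ereal" where
  "max_deviation D d \<alpha> k n S =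
     (SUP (x, \<Lambda>) \<in> unit_cube d \<times> valid_partitions d \<alpha> k n S.
        ereal \<bar>valid_tree n S \<Lambda> x - optimal_tree D \<Lambda> x\<bar>)"

end

theory Submission
  imports Defs "HOL-Real_Asymp.Real_Asymp"
begin

text \<open>
  Let \<open>X\<close> be uniform on the cube and let \<open>Y\<close> be an independent fair sign \<open>\<plusminus>M\<close>. Every
  partition-optimal tree is then identically zero, so the deviation is the largest absolute mean
  of the labels in a leaf. A union bound over the roughly $d^L$ leaves of depth \<open>L\<close> would suggest
  a maximum of order $M \sqrt{L \log d / k}$; the point is that this order is really attained, even
  though the leaves overlap. Splitting greedily does not achieve it: the gains in the mean along
  one path form a geometric series, so the factor $\log n$ is lost.

  The leaves used are boxes: cut the first \<open>L * q\<close> features into \<open>L\<close> blocks of size \<open>q\<close>,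
  choose one feature from each block by a function \<open>g\<close>, and keep the points whose chosen
  coordinates are all at most \<open>1/2\<close>. Two boxes whose functions agree in \<open>s\<close> places share only an
  expected fraction $2^{s-L}$ of their points, and agreement in many places is rare. With
  \<open>S\<^sub>g\<close> for the sum of the signs in box \<open>g\<close>, consider the average over \<open>g\<close> of the exponential
  weights \<open>w\<^sub>g = exp (\<theta> * S\<^sub>g) / \<phi>\<close>, normalised to expectation one. Since the sample is i.i.d.,
  the second moment of this average is explicit (\<open>pair_mgf_product_bound\<close>,
  \<open>sum_exp_agreements\<close>), and it tends to one. Hence the average is close to one with high
  probability.

  On the other hand, under the law reweighted by \<open>w\<^sub>g\<close>, box \<open>g\<close> is good with high probability:
  its label mean reaches the target, and all boxes on the path to it have nearly their expected
  number of points, so that the box is a valid leaf (\<open>half_box_chain_valid\<close>). The total weight of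
  the bad boxes is therefore small in expectation. If no box were good, the average weight would
  consist of bad boxes only; it cannot be both close to one and small. This argument,
  \<open>deviation_probability_bound\<close>, avoids any lower bound on binomial tails.

  For the limit take $2^L \approx n^{3/4}$, the leaf size \<open>k\<close> about a third of the expected box
  size \<open>m\<close> of order $n^{1/4}$, and \<open>\<theta> = sqrt (ln n * ln d / k) / 2\<close>. The second moment
  needs \<open>m * \<theta>\<^sup>2\<close> to stay below the entropy \<open>L * ln q\<close>: the former is at most
  \<open>3/4 * ln n * ln d\<close>, while the latter is about \<open>3 / (4 * ln 2) * ln n * ln d\<close>.

  Finally, the deviation event involves uncountably many thresholds, and a non-measurable event
  would have probability zero by convention. It is measurable, because the index sets of valid
  leaves depend only on the finite order pattern of the coordinates (\<open>data_in_valid_nodes\<close>).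
\<close>

section \<open>Valid nodes and measurability of the deviation event\<close>

text \<open>
  The cells of valid partitions can be generated one path at a time: all siblings along the path
  already hold \<open>k\<close> points and may stay unsplit. This replaces partitions by single cells.
\<close>

inductive_set valid_nodes ::
    "nat \<Rightarrow> real \<Rightarrow> nat \<Rightarrow> nat \<Rightarrow> (nat \<Rightarrow> (nat \<Rightarrow> real) \<times> real) \<Rightarrow> (nat \<Rightarrow> real) set set"
  for d :: nat and \<alpha> :: real and k n :: nat and S :: "nat \<Rightarrow> (nat \<Rightarrow> real) \<times> real" where
  root: "card (data_in n S (unit_cube d)) \<ge> k \<Longrightarrow> unit_cube d \<in> valid_nodes d \<alpha> k n S"
| child:
    "\<lbrakk> \<nu> \<in> valid_nodes d \<alpha> k n S; j < d; 0 \<le> \<tau>; \<tau> \<le> 1;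
       \<nu>\<^sub>l = \<nu> \<inter> {x. x j \<le> \<tau>}; \<nu>\<^sub>r = \<nu> \<inter> {x. x j > \<tau>}; \<mu> \<in> {\<nu>\<^sub>l, \<nu>\<^sub>r};
       \<forall>\<rho>\<in>{\<nu>\<^sub>l, \<nu>\<^sub>r}. card (data_in n S \<rho>) \<ge> k \<and>
         real (card (data_in n S \<rho>)) \<ge> \<alpha> * real (card (data_in n S \<nu>)) \<rbrakk>
     \<Longrightarrow> \<mu> \<in> valid_nodes d \<alpha> k n S"

lemma finite_data_in: "finite (data_in n S \<nu>)"
  by (simp add: data_in_def)

lemma card_data_in_mono: "\<nu> \<subseteq> \<mu> \<Longrightarrow> card (data_in n S \<nu>) \<le> card (data_in n S \<mu>)"
  by (intro card_mono finite_data_in) (auto simp: data_in_def)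

text \<open>
  A split node contains its children, hence at least \<open>k\<close> points; so undoing the last split of a
  valid partition leaves a valid partition.
\<close>

lemma valid_partition_member_valid_node:
  assumes "\<Lambda> \<in> valid_partitions d \<alpha> k n S" "\<nu> \<in> \<Lambda>"
  shows "\<nu> \<in> valid_nodes d \<alpha> k n S"
proof -
  have "\<Lambda> \<in> recursive_partitions d \<alpha> n S" "\<forall>\<nu>\<in>\<Lambda>. card (data_in n S \<nu>) \<ge> k"
    using assms(1) by (auto simp: valid_partitions_def)
  then show ?thesis using assms(2)
  proof (induction arbitrary: \<nu>)
    case root
    then show ?case by (auto intro: valid_nodes.root)
  next
    case (split \<Lambda> \<mu> j \<tau> \<mu>\<^sub>l \<mu>\<^sub>r)
    have k: "card (data_in n S \<mu>\<^sub>l) \<ge> k" "card (data_in n S \<mu>\<^sub>r) \<ge> k"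
      using split.prems by auto
    have "card (data_in n S \<mu>) \<ge> k"
      using k(1) card_data_in_mono[of "\<mu>\<^sub>l" \<mu> n S] split.hyps(6) by auto
    then have all: "\<forall>\<rho>\<in>\<Lambda>. card (data_in n S \<rho>) \<ge> k"
      using split.prems(1) by auto
    show ?case
    proof (cases "\<nu> \<in> \<Lambda>")
      case True
      then show ?thesis using split.IH all by blast
    next
      case False
      then have child: "\<nu> \<in> {\<mu>\<^sub>l, \<mu>\<^sub>r}" using split.prems by blast
      have parent: "\<mu> \<in> valid_nodes d \<alpha> k n S" using split.IH all split.hyps(2) by blast
      have "\<forall>\<rho>\<in>{\<mu>\<^sub>l, \<mu>\<^sub>r}. card (data_in n S \<rho>) \<ge> k \<and>
          real (card (data_in n S \<rho>)) \<ge> \<alpha> * real (card (data_in n S \<mu>))"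
        using k split.hyps(8,9) by blast
      then show ?thesis by (rule valid_nodes.child[OF parent split.hyps(3-7) child])
    qed
  qed
qed

lemma valid_node_in_valid_partition:
  assumes "\<nu> \<in> valid_nodes d \<alpha> k n S"
  shows "\<exists>\<Lambda>\<in>valid_partitions d \<alpha> k n S. \<nu> \<in> \<Lambda>"
  using assms
proof induction
  case root
  then have "{unit_cube d} \<in> valid_partitions d \<alpha> k n S"
    by (auto simp: valid_partitions_def intro: recursive_partitions.root)
  then show ?case by blast
next
  case (child \<nu> j \<tau> \<nu>\<^sub>l \<nu>\<^sub>r \<mu>)
  then obtain \<Lambda> where \<Lambda>: "\<Lambda> \<in> valid_partitions d \<alpha> k n S" "\<nu> \<in> \<Lambda>" by blast
  then have rec: "\<Lambda> \<in> recursive_partitions d \<alpha> n S" by (simp add: valid_partitions_def)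
  have large: "real (card (data_in n S \<nu>\<^sub>l)) \<ge> \<alpha> * real (card (data_in n S \<nu>))"
    "real (card (data_in n S \<nu>\<^sub>r)) \<ge> \<alpha> * real (card (data_in n S \<nu>))"
    and k: "card (data_in n S \<nu>\<^sub>l) \<ge> k" "card (data_in n S \<nu>\<^sub>r) \<ge> k"
    using bspec[OF child.hyps(8), of \<nu>\<^sub>l] bspec[OF child.hyps(8), of \<nu>\<^sub>r] by blast+
  have "\<Lambda> - {\<nu>} \<union> {\<nu>\<^sub>l, \<nu>\<^sub>r} \<in> recursive_partitions d \<alpha> n S"
    by (rule recursive_partitions.split[OF rec \<Lambda>(2) child.hyps(2-6) large])
  moreover have "\<forall>\<rho>\<in>\<Lambda> - {\<nu>} \<union> {\<nu>\<^sub>l, \<nu>\<^sub>r}. card (data_in n S \<rho>) \<ge> k"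
    using k \<Lambda>(1) by (auto simp only: valid_partitions_def mem_Collect_eq Un_iff insert_iff empty_iff Diff_iff)
  ultimately have "\<Lambda> - {\<nu>} \<union> {\<nu>\<^sub>l, \<nu>\<^sub>r} \<in> valid_partitions d \<alpha> k n S"
    by (simp only: valid_partitions_def mem_Collect_eq simp_thms)
  then show ?case by (rule bexI[rotated]) (use child.hyps(7) in \<open>simp only: Un_iff simp_thms\<close>)
qed

lemma leaf_eq:
  assumes "\<Lambda> \<in> recursive_partitions d \<alpha> n S" "x \<in> unit_cube d" "\<nu> \<in> \<Lambda>" "x \<in> \<nu>"
  shows "leaf \<Lambda> x = \<nu>"
  unfolding leaf_def using leaf_unique[OF assms(1,2)] assms(3,4) by (intro the1_equality) auto

lemma valid_node_subset_cube: "\<nu> \<in> valid_nodes d \<alpha> k n S \<Longrightarrow> \<nu> \<subseteq> unit_cube d"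
  by (induction rule: valid_nodes.induct) auto

lemma card_valid_node: "\<nu> \<in> valid_nodes d \<alpha> k n S \<Longrightarrow> card (data_in n S \<nu>) \<ge> k"
  by (induction rule: valid_nodes.induct) auto

definition sample_mean :: "(nat \<Rightarrow> (nat \<Rightarrow> real) \<times> real) \<Rightarrow> nat set \<Rightarrow> real" where
  "sample_mean S I = (\<Sum>i\<in>I. snd (S i)) / real (card I)"

text \<open>
  Only finitely many label means occur for a given sample, so the supremum is attained. Since
  \<open>k > 0\<close>, a valid cell contains a data point, which serves as the point \<open>x\<close> of the supremum.
\<close>

lemma max_deviation_ge_iff:
  assumes k: "k > 0" and cond_mean: "\<And>L. cond_mean D L = 0"
  shows "max_deviation D d \<alpha> k n S \<ge> ereal c \<longleftrightarrow>
    (\<exists>I \<in> data_in n S ` valid_nodes d \<alpha> k n S. c \<le> \<bar>sample_mean S I\<bar>)"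
proof -
  let ?A = "(\<lambda>(x, \<Lambda>). ereal \<bar>valid_tree n S \<Lambda> x - optimal_tree D \<Lambda> x\<bar>) `
      (unit_cube d \<times> valid_partitions d \<alpha> k n S)"
  let ?B = "(\<lambda>I. ereal \<bar>sample_mean S I\<bar>) ` data_in n S ` valid_nodes d \<alpha> k n S"
  have "?A = ?B"
  proof (intro set_eqI iffI)
    fix z assume "z \<in> ?A"
    then obtain x \<Lambda> where x: "x \<in> unit_cube d" "\<Lambda> \<in> valid_partitions d \<alpha> k n S"
      and z: "z = ereal \<bar>valid_tree n S \<Lambda> x - optimal_tree D \<Lambda> x\<bar>" by auto
    have rec: "\<Lambda> \<in> recursive_partitions d \<alpha> n S" using x by (simp add: valid_partitions_def)
    obtain \<nu> where \<nu>: "\<nu> \<in> \<Lambda>" "x \<in> \<nu>" using leaf_unique[OF rec x(1)] by blast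
    then have "leaf \<Lambda> x = \<nu>" using leaf_eq rec x by blast
    then have "z = ereal \<bar>sample_mean S (data_in n S \<nu>)\<bar>"
      by (simp add: z valid_tree_def optimal_tree_def cond_mean sample_mean_def)
    then show "z \<in> ?B"
      using valid_partition_member_valid_node[OF x(2) \<nu>(1)] by blast
  next
    fix z assume "z \<in> ?B"
    then obtain \<nu> where \<nu>: "\<nu> \<in> valid_nodes d \<alpha> k n S"
      and z: "z = ereal \<bar>sample_mean S (data_in n S \<nu>)\<bar>" by auto
    obtain \<Lambda> where \<Lambda>: "\<Lambda> \<in> valid_partitions d \<alpha> k n S" "\<nu> \<in> \<Lambda>"
      using valid_node_in_valid_partition[OF \<nu>] by blast
    have "data_in n S \<nu> \<noteq> {}" using card_valid_node[OF \<nu>] k by auto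
    then obtain x where x: "x \<in> \<nu>" by (auto simp: data_in_def)
    then have xc: "x \<in> unit_cube d" using valid_node_subset_cube[OF \<nu>] by auto
    have rec: "\<Lambda> \<in> recursive_partitions d \<alpha> n S" using \<Lambda> by (simp add: valid_partitions_def)
    have "leaf \<Lambda> x = \<nu>" using leaf_eq[OF rec xc \<Lambda>(2) x] .
    then have "z = ereal \<bar>valid_tree n S \<Lambda> x - optimal_tree D \<Lambda> x\<bar>"
      by (simp add: z valid_tree_def optimal_tree_def cond_mean sample_mean_def)
    then show "z \<in> ?A" using xc \<Lambda>(1) by (intro image_eqI[of _ _ "(x, \<Lambda>)"]) auto
  qed
  then have eq: "max_deviation D d \<alpha> k n S = Sup ?B"
    unfolding max_deviation_def by simp
  have fin: "finite ?B"
  proof -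
    have "data_in n S ` valid_nodes d \<alpha> k n S \<subseteq> Pow {..<n}" by (auto simp: data_in_def)
    then have "finite (data_in n S ` valid_nodes d \<alpha> k n S)" by (rule finite_subset) simp
    then show ?thesis by (rule finite_imageI)
  qed
  show ?thesis
  proof (cases "?B = {}")
    case True
    then show ?thesis unfolding eq by (simp add: bot_ereal_def)
  next
    case False
    have "ereal c \<le> Sup ?B \<longleftrightarrow> (\<exists>b\<in>?B. ereal c \<le> b)"
      unfolding Max_Sup[OF fin False, symmetric] by (rule Max_ge_iff[OF fin False])
    also have "\<dots> \<longleftrightarrow> (\<exists>I\<in>data_in n S ` valid_nodes d \<alpha> k n S. c \<le> \<bar>sample_mean S I\<bar>)"
      by auto
    finally show ?thesis unfolding eq .
  qed
qed

text \<open>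
  The same process on index sets. A triple \<open>(j, i, h)\<close> in the pattern \<open>P\<close> says that point \<open>i\<close>
  is at most point \<open>h\<close> in coordinate \<open>j\<close>, and every split is at the value of a data point \<open>h\<close>.
  For the pattern of a sample, \<open>(j, h, h) \<in> P\<close> says that \<open>j\<close> and \<open>h\<close> are in range.
\<close>

inductive_set valid_index_sets ::
    "real \<Rightarrow> nat \<Rightarrow> nat \<Rightarrow> (nat \<times> nat \<times> nat) set \<Rightarrow> nat set set"
  for \<alpha> :: real and k n :: nat and P :: "(nat \<times> nat \<times> nat) set" where
  root: "k \<le> n \<Longrightarrow> {..<n} \<in> valid_index_sets \<alpha> k n P"
| child:
    "\<lbrakk> I \<in> valid_index_sets \<alpha> k n P; (j, h, h) \<in> P;
       I\<^sub>l = {i\<in>I. (j, i, h) \<in> P}; I\<^sub>r = {i\<in>I. (j, i, h) \<notin> P}; C \<in> {I\<^sub>l, I\<^sub>r};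
       \<forall>I'\<in>{I\<^sub>l, I\<^sub>r}. card I' \<ge> k \<and> real (card I') \<ge> \<alpha> * real (card I) \<rbrakk>
     \<Longrightarrow> C \<in> valid_index_sets \<alpha> k n P"

definition order_pattern ::
    "nat \<Rightarrow> nat \<Rightarrow> (nat \<Rightarrow> (nat \<Rightarrow> real) \<times> real) \<Rightarrow> (nat \<times> nat \<times> nat) set" where
  "order_pattern d n S =
     {(j, i, h). j < d \<and> i < n \<and> h < n \<and> fst (S i) j \<le> fst (S h) j}"

lemma data_in_Int: "data_in n S (\<nu> \<inter> A) = {i \<in> data_in n S \<nu>. fst (S i) \<in> A}"
  by (auto simp: data_in_def)

text \<open>
  A split whose left child contains data selects the same points when its threshold is lowered to
  the largest coordinate in that child. Splits with an empty child do not occur, as \<open>k > 0\<close>.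
\<close>

lemma data_in_valid_nodes:
  assumes cube: "\<And>i. i < n \<Longrightarrow> fst (S i) \<in> unit_cube d" and k: "k > 0"
  shows "data_in n S ` valid_nodes d \<alpha> k n S = valid_index_sets \<alpha> k n (order_pattern d n S)"
proof -
  have 0: "data_in n S (unit_cube d) = {..<n}"
    using cube by (auto simp: data_in_def)
  have "data_in n S \<nu> \<in> valid_index_sets \<alpha> k n (order_pattern d n S)"
    if "\<nu> \<in> valid_nodes d \<alpha> k n S" for \<nu>
    using that
  proof induction
    case root
    then show ?case unfolding 0 by (auto intro: valid_index_sets.root)
  next
    case (child \<nu> j \<tau> \<nu>\<^sub>l \<nu>\<^sub>r \<mu>)
    have l: "data_in n S \<nu>\<^sub>l = {i \<in> data_in n S \<nu>. fst (S i) j \<le> \<tau>}"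
      unfolding child by (subst data_in_Int) auto
    have r: "data_in n S \<nu>\<^sub>r = {i \<in> data_in n S \<nu>. fst (S i) j > \<tau>}"
      unfolding child by (subst data_in_Int) auto
    let ?V = "(\<lambda>i. fst (S i) j) ` data_in n S \<nu>\<^sub>l"
    have "data_in n S \<nu>\<^sub>l \<noteq> {}" using child k by fastforce
    then have "Max ?V \<in> ?V" by (intro Max_in) (auto simp: finite_data_in)
    then obtain h where h: "h \<in> data_in n S \<nu>\<^sub>l" and "fst (S h) j = Max ?V" by auto
    then have max: "fst (S i) j \<le> fst (S h) j" if "i \<in> data_in n S \<nu>\<^sub>l" for i
      using that by (simp add: finite_data_in)
    have hn: "h < n" using h by (auto simp: data_in_def)
    have bound: "i < n" if "i \<in> data_in n S \<nu>" for i
      using that by (auto simp: data_in_def)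
    have iff: "fst (S i) j \<le> \<tau> \<longleftrightarrow> (j, i, h) \<in> order_pattern d n S" if "i \<in> data_in n S \<nu>" for i
      using that hn child.hyps(2) max[of i] h bound[of i] by (auto simp: order_pattern_def l)
    have l': "data_in n S \<nu>\<^sub>l = {i \<in> data_in n S \<nu>. (j, i, h) \<in> order_pattern d n S}"
      using iff unfolding l by auto
    have r': "data_in n S \<nu>\<^sub>r = {i \<in> data_in n S \<nu>. (j, i, h) \<notin> order_pattern d n S}"
      using iff unfolding r by (auto simp: not_le[symmetric])
    show ?case
      using child.hyps(7,8) hn child.hyps(2)
      by (intro valid_index_sets.child[OF child.IH _ l' r']) (auto simp: order_pattern_def)
  qed
  moreover have "I \<in> data_in n S ` valid_nodes d \<alpha> k n S"
    if "I \<in> valid_index_sets \<alpha> k n (order_pattern d n S)" for I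
    using that
  proof induction
    case root
    then show ?case using valid_nodes.root[of k n S d \<alpha>] unfolding 0 by (metis 0 card_lessThan imageI)
  next
    case (child I j h I\<^sub>l I\<^sub>r C)
    then obtain \<nu> where \<nu>: "\<nu> \<in> valid_nodes d \<alpha> k n S" and I: "I = data_in n S \<nu>" by blast
    have jh: "j < d" "h < n" using child.hyps(2) by (auto simp: order_pattern_def)
    define \<nu>\<^sub>l where "\<nu>\<^sub>l = \<nu> \<inter> {x. x j \<le> fst (S h) j}"
    define \<nu>\<^sub>r where "\<nu>\<^sub>r = \<nu> \<inter> {x. x j > fst (S h) j}"
    have I\<^sub>l: "data_in n S \<nu>\<^sub>l = I\<^sub>l" and I\<^sub>r: "data_in n S \<nu>\<^sub>r = I\<^sub>r"
      unfolding child I \<nu>\<^sub>l_def \<nu>\<^sub>r_def data_in_Int using jh by (auto simp: order_pattern_def data_in_def)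
    have \<tau>: "0 \<le> fst (S h) j" "fst (S h) j \<le> 1"
      using cube[OF jh(2)] jh(1) by (auto simp: unit_cube_def PiE_iff)
    have "\<mu> \<in> valid_nodes d \<alpha> k n S" if "\<mu> \<in> {\<nu>\<^sub>l, \<nu>\<^sub>r}" for \<mu>
      using child that I\<^sub>l I\<^sub>r I
      by (intro valid_nodes.child[OF \<nu> jh(1) \<tau> \<nu>\<^sub>l_def \<nu>\<^sub>r_def]) auto
    then show ?case using child.hyps(5) I\<^sub>l I\<^sub>r by blast
  qed
  ultimately show ?thesis by blast
qed

text \<open>
  The event is a finite union, over order patterns and index sets, of events given by comparing
  finitely many coordinates and one label mean with a constant.
\<close>

lemma measurable_deviation_event:
  assumes sets: "sets D = sets (cube_measure d \<Otimes>\<^sub>M restrict_space borel {-M..M})"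
    and k: "k > 0" and cond_mean: "\<And>L. cond_mean D L = 0"
  shows "{S \<in> space (\<Pi>\<^sub>M i\<in>{..<n}. D). max_deviation D d \<alpha> k n S \<ge> ereal c}
    \<in> sets (\<Pi>\<^sub>M i\<in>{..<n}. D)"
proof -
  let ?P = "\<Pi>\<^sub>M i\<in>{..<n}. D"
  let ?U = "{..<d} \<times> {..<n} \<times> {..<n}"
  have spD: "space D = unit_cube d \<times> {-M..M}"
    using sets_eq_imp_space_eq[OF sets] by (simp add: space_pair_measure space_cube_measure)
  have cube: "fst (S i) \<in> unit_cube d" if "S \<in> space ?P" "i < n" for S i
    using that by (auto simp: space_PiM spD PiE_iff mem_Times_iff)
  have comp: "(\<lambda>S. S i) \<in> measurable ?P (cube_measure d \<Otimes>\<^sub>M restrict_space borel {-M..M})"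
    if "i < n" for i
  proof -
    have "(\<lambda>S. S i) \<in> measurable ?P D" using that by (intro measurable_component_singleton) simp
    then show ?thesis unfolding measurable_cong_sets[OF refl sets] .
  qed
  have meas_y: "(\<lambda>S. snd (S i)) \<in> borel_measurable ?P" if "i < n" for i
    using measurable_compose[OF comp[OF that] measurable_snd]
    by (auto dest: measurable_restrict_space2_iff[THEN iffD1])
  have meas_x: "(\<lambda>S. fst (S i) j) \<in> borel_measurable ?P" if "i < n" "j < d" for i j
  proof -
    have "(\<lambda>x. x j) \<in> measurable (cube_measure d) (restrict_space lborel {0..1})"
      using that by (auto simp: cube_measure_def)
    then have "(\<lambda>S. fst (S i) j) \<in> measurable ?P (restrict_space lborel {0..1})"
      using measurable_compose[OF measurable_compose[OF comp[OF that(1)] measurable_fst]] by blast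
    then show ?thesis by (auto dest: measurable_restrict_space2_iff[THEN iffD1])
  qed
  have meas_mean: "(\<lambda>S. sample_mean S I) \<in> borel_measurable ?P" if "I \<subseteq> {..<n}" for I
    unfolding sample_mean_def using that meas_y by (intro borel_measurable_divide borel_measurable_sum) auto
  have pat: "order_pattern d n S = Q \<longleftrightarrow>
      (\<forall>(j, i, h)\<in>?U. fst (S i) j \<le> fst (S h) j \<longleftrightarrow> (j, i, h) \<in> Q)" if "Q \<in> Pow ?U" for S Q
    using that unfolding order_pattern_def by auto
  have Isub: "I \<subseteq> {..<n}" if "I \<in> valid_index_sets \<alpha> k n Q" for I Q
    using that by induction auto
  have "max_deviation D d \<alpha> k n S \<ge> ereal c \<longleftrightarrow>
      (\<exists>Q\<in>Pow ?U. (\<forall>(j, i, h)\<in>?U. fst (S i) j \<le> fst (S h) j \<longleftrightarrow> (j, i, h) \<in> Q) \<and>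
        (\<exists>I\<in>valid_index_sets \<alpha> k n Q \<inter> Pow {..<n}. c \<le> \<bar>sample_mean S I\<bar>))"
    if "S \<in> space ?P" for S
  proof -
    have "max_deviation D d \<alpha> k n S \<ge> ereal c \<longleftrightarrow>
        (\<exists>I\<in>valid_index_sets \<alpha> k n (order_pattern d n S). c \<le> \<bar>sample_mean S I\<bar>)"
      unfolding max_deviation_ge_iff[OF k cond_mean]
      by (simp only: data_in_valid_nodes[OF cube[OF that] k])
    also have "\<dots> \<longleftrightarrow> (\<exists>Q\<in>Pow ?U. order_pattern d n S = Q \<and>
        (\<exists>I\<in>valid_index_sets \<alpha> k n Q \<inter> Pow {..<n}. c \<le> \<bar>sample_mean S I\<bar>))"
      using Isub by (auto simp: order_pattern_def)
    also have "\<dots> \<longleftrightarrow> (\<exists>Q\<in>Pow ?U.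
        (\<forall>(j, i, h)\<in>?U. fst (S i) j \<le> fst (S h) j \<longleftrightarrow> (j, i, h) \<in> Q) \<and>
        (\<exists>I\<in>valid_index_sets \<alpha> k n Q \<inter> Pow {..<n}. c \<le> \<bar>sample_mean S I\<bar>))"
      using pat by (intro bex_cong refl conj_cong)
    finally show ?thesis .
  qed
  then have "{S \<in> space ?P. max_deviation D d \<alpha> k n S \<ge> ereal c} =
     {S \<in> space ?P. \<exists>Q\<in>Pow ?U.
        (\<forall>u\<in>?U. case u of (j, i, h) \<Rightarrow> fst (S i) j \<le> fst (S h) j \<longleftrightarrow> (j, i, h) \<in> Q) \<and>
        (\<exists>I\<in>valid_index_sets \<alpha> k n Q \<inter> Pow {..<n}. c \<le> \<bar>sample_mean S I\<bar>)}"
    by blast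
  also have "\<dots> \<in> sets ?P"
  proof (intro sets.sets_Collect_finite_Ex sets.sets_Collect_conj sets.sets_Collect_finite_All)
    fix Q u assume "u \<in> ?U"
    then obtain j i h where u: "u = (j, i, h)" "j < d" "i < n" "h < n" by auto
    have "{S \<in> space ?P. fst (S i) j \<le> fst (S h) j} \<in> sets ?P"
      by (rule borel_measurable_le[OF meas_x[OF u(3,2)] meas_x[OF u(4,2)]])
    then show "{S \<in> space ?P. case u of (j, i, h) \<Rightarrow> fst (S i) j \<le> fst (S h) j \<longleftrightarrow> (j, i, h) \<in> Q} \<in> sets ?P"
      unfolding u prod.case
      by (cases "(j, i, h) \<in> Q") (simp_all only: simp_thms sets.sets_Collect_neg)
  next
    fix Q I assume "I \<in> valid_index_sets \<alpha> k n Q \<inter> Pow {..<n}"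
    then have "(\<lambda>S. sample_mean S I) \<in> borel_measurable ?P" by (intro meas_mean) auto
    then show "{S \<in> space ?P. c \<le> \<bar>sample_mean S I\<bar>} \<in> sets ?P"
      by (intro borel_measurable_le borel_measurable_abs borel_measurable_const)
  qed (simp_all only: finite_Int finite_Pow_iff finite_cartesian_product finite_lessThan simp_thms)
  finally show ?thesis .
qed

section \<open>Uniform features with independent random signs\<close>

definition sign_measure :: "real \<Rightarrow> real measure" where
  "sign_measure M = distr (measure_pmf (bernoulli_pmf (1/2))) (restrict_space borel {-M..M})
     (\<lambda>b. if b then M else - M)"

definition coin_law :: "nat \<Rightarrow> real \<Rightarrow> ((nat \<Rightarrow> real) \<times> real) measure" where
  "coin_law d M = cube_measure d \<Otimes>\<^sub>M sign_measure M"

lemma prob_space_unit_interval: "prob_space (restrict_space lborel {0..1::real})"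
  by (intro prob_spaceI) (simp add: space_restrict_space emeasure_restrict_space)

lemma prob_space_cube_measure: "prob_space (cube_measure d)"
  unfolding cube_measure_def by (intro prob_space_PiM prob_space_unit_interval)

lemma sign_map_measurable:
  "M > 0 \<Longrightarrow> (\<lambda>b. if b then M else - M) \<in>
    measurable (measure_pmf (bernoulli_pmf (1/2))) (restrict_space borel {-M..M::real})"
  by (simp add: space_restrict_space)

lemma prob_space_sign_measure: "M > 0 \<Longrightarrow> prob_space (sign_measure M)"
  unfolding sign_measure_def
  by (intro prob_space.prob_space_distr sign_map_measurable prob_space_measure_pmf)

lemma sets_sign_measure: "sets (sign_measure M) = sets (restrict_space borel {-M..M})"
  by (simp add: sign_measure_def)

lemma integral_sign_measure:
  assumes "M > 0" "f \<in> borel_measurable borel"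
  shows "(\<integral>y. f y \<partial>sign_measure M) = (f M + f (- M)) / (2 :: real)"
proof -
  have "f \<in> borel_measurable (restrict_space borel {-M..M})"
    using assms(2) by (rule measurable_restrict_space1)
  then show ?thesis
    unfolding sign_measure_def
    by (subst integral_distr[OF sign_map_measurable[OF assms(1)]]) (simp_all add: field_simps)
qed

lemma prob_space_coin_law: "M > 0 \<Longrightarrow> prob_space (coin_law d M)"
proof -
  assume "M > 0"
  interpret C: prob_space "cube_measure d" by (rule prob_space_cube_measure)
  interpret Y: prob_space "sign_measure M" by (rule prob_space_sign_measure) fact
  interpret pair_prob_space "cube_measure d" "sign_measure M" ..
  show ?thesis unfolding coin_law_def by unfold_locales
qed

lemma sets_coin_law: "sets (coin_law d M) = sets (cube_measure d \<Otimes>\<^sub>M restrict_space borel {-M..M})"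
  unfolding coin_law_def by (intro sets_pair_measure_cong refl sets_sign_measure)

lemma space_coin_law: "space (coin_law d M) = unit_cube d \<times> {-M..M}"
  using sets_eq_imp_space_eq[OF sets_coin_law] by (simp add: space_pair_measure space_cube_measure)

lemma distributed_fst_coin_law:
  assumes "M > 0"
  shows "distributed (coin_law d M) (cube_measure d) fst (\<lambda>x. ennreal 1)"
proof -
  interpret Y: prob_space "sign_measure M" by (rule prob_space_sign_measure) fact
  have "distr (coin_law d M) (cube_measure d) fst = cube_measure d"
    unfolding coin_law_def by (rule Y.distr_pair_fst)
  moreover have "density (cube_measure d) (\<lambda>x. ennreal 1) = cube_measure d"
    by (simp add: density_1)
  ultimately show ?thesis
    by (auto simp: distributed_def coin_law_def)
qed

text \<open>
  The cell \<open>L\<close> may be an arbitrary, even non-measurable, set: either the integrand is not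
  integrable and the Bochner integral is zero by convention, or Fubini's theorem leaves the mean
  of a fair sign inside.
\<close>

lemma cond_mean_coin_law:
  assumes "M > 0"
  shows "cond_mean (coin_law d M) L = 0"
proof -
  let ?D = "coin_law d M"
  let ?f = "\<lambda>z. indicator {z \<in> space ?D. fst z \<in> L} z *\<^sub>R snd z :: real"
  interpret C: prob_space "cube_measure d" by (rule prob_space_cube_measure)
  interpret Y: prob_space "sign_measure M" by (rule prob_space_sign_measure) fact
  interpret pair_prob_space "cube_measure d" "sign_measure M" ..
  have "integral\<^sup>L ?D ?f = 0"
  proof (cases "integrable ?D ?f")
    case True
    have "integral\<^sup>L ?D ?f = (\<integral>x. \<integral>y. ?f (x, y) \<partial>sign_measure M \<partial>cube_measure d)"
      using integral_fst'[of ?f] True unfolding coin_law_def by simp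
    also have "\<dots> = (\<integral>x. 0 \<partial>cube_measure d)"
    proof (intro Bochner_Integration.integral_cong refl)
      fix x assume x: "x \<in> space (cube_measure d)"
      have "(\<integral>y. ?f (x, y) \<partial>sign_measure M) = (\<integral>y. indicator L x * y \<partial>sign_measure M)"
      proof (intro Bochner_Integration.integral_cong refl)
        fix y assume "y \<in> space (sign_measure M)"
        then show "?f (x, y) = indicator L x * y"
          using x by (simp add: coin_law_def space_pair_measure indicator_def)
      qed
      also have "\<dots> = 0"
        by (subst integral_sign_measure[OF assms]) auto
      finally show "(\<integral>y. ?f (x, y) \<partial>sign_measure M) = 0" .
    qed
    finally show ?thesis by simp
  qed (rule not_integrable_integral_eq)
  then show ?thesis by (simp add: cond_mean_def set_lebesgue_integral_def)
qed

definition half_box :: "nat \<Rightarrow> nat set \<Rightarrow> (nat \<Rightarrow> real) set" where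
  "half_box d A = {x \<in> unit_cube d. \<forall>j\<in>A. x j \<le> 1/2}"

lemma half_box_PiE:
  "A \<subseteq> {..<d} \<Longrightarrow> half_box d A = (\<Pi>\<^sub>E j\<in>{..<d}. if j \<in> A then {0..1/2} else {0..1})"
proof (intro set_eqI iffI)
  assume A: "A \<subseteq> {..<d}"
  fix x
  show "x \<in> (\<Pi>\<^sub>E j\<in>{..<d}. if j \<in> A then {0..1/2} else {0..1})" if "x \<in> half_box d A"
    using that A by (auto simp: half_box_def unit_cube_def PiE_iff)
  show "x \<in> half_box d A" if x: "x \<in> (\<Pi>\<^sub>E j\<in>{..<d}. if j \<in> A then {0..1/2} else {0..1})"
  proof -
    have ext: "x \<in> extensional {..<d}" using x by (simp add: PiE_iff)
    have c: "x j \<in> (if j \<in> A then {0..1/2} else {0..1})" if "j < d" for j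
      using x that by (auto simp only: PiE_iff lessThan_iff)
    have "x j \<in> {0..1}" if "j < d" for j using c[OF that] by (auto split: if_splits)
    moreover have "x j \<le> 1/2" if "j \<in> A" for j
      using c[of j] A that by auto
    ultimately show ?thesis using ext by (auto simp: half_box_def unit_cube_def PiE_iff)
  qed
qed

lemma half_box_measurable: "A \<subseteq> {..<d} \<Longrightarrow> half_box d A \<in> sets (cube_measure d)"
  unfolding half_box_PiE cube_measure_def
  by (intro sets_PiM_I_finite) (auto simp: sets_restrict_space_iff)

lemma measure_half_box:
  assumes "A \<subseteq> {..<d}"
  shows "measure (cube_measure d) (half_box d A) = 1 / 2 ^ card A"
proof -
  interpret I: prob_space "restrict_space lborel {0..1::real}" by (rule prob_space_unit_interval)
  interpret product_prob_space "\<lambda>_. restrict_space lborel {0..1::real}" "{..<d}" ..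
  interpret finite_product_prob_space "\<lambda>_. restrict_space lborel {0..1::real}" "{..<d}"
    by unfold_locales simp
  have "measure (cube_measure d) (half_box d A) =
      (\<Prod>j<d. measure (restrict_space lborel {0..1::real}) (if j \<in> A then {0..1/2} else {0..1}))"
    unfolding half_box_PiE[OF assms] cube_measure_def
    by (rule finite_measure_PiM_emb) (auto simp: sets_restrict_space_iff)
  also have "\<dots> = (\<Prod>j<d. if j \<in> A then 1/2 else 1)"
    by (intro prod.cong refl) (auto simp: measure_restrict_space)
  also have "\<dots> = (\<Prod>j\<in>A. 1/2)"
    using assms by (simp add: prod.If_cases Int_absorb1)
  finally show ?thesis by (simp add: power_one_over)
qed

definition vote :: "nat \<Rightarrow> nat \<Rightarrow> (nat \<Rightarrow> (nat \<Rightarrow> real) \<times> real) \<Rightarrow> nat set \<Rightarrow> real" where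
  "vote d n S A = (\<Sum>i<n. snd (S i) * of_bool (fst (S i) \<in> half_box d A))"

definition occupancy :: "nat \<Rightarrow> nat \<Rightarrow> (nat \<Rightarrow> (nat \<Rightarrow> real) \<times> real) \<Rightarrow> nat set \<Rightarrow> real" where
  "occupancy d n S A = (\<Sum>i<n. of_bool (fst (S i) \<in> half_box d A))"

lemma occupancy_eq_card: "occupancy d n S A = real (card (data_in n S (half_box d A)))"
  by (simp add: occupancy_def data_in_def Int_def)

lemma vote_eq_sum: "vote d n S A = (\<Sum>i\<in>data_in n S (half_box d A). snd (S i))"
  by (simp add: vote_def data_in_def Int_def)

text \<open>
  The joint moment generating function, for one data point, of the label and the membership in two
  boxes. The four summands are the four cells cut out by the boxes; the label contributes a
  hyperbolic cosine.
\<close>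

definition pair_mgf :: "real \<Rightarrow> nat set \<Rightarrow> nat set \<Rightarrow> real \<Rightarrow> real \<Rightarrow> real \<Rightarrow> real \<Rightarrow> real" where
  "pair_mgf M A B a a' b b' =
     (let p = 1 / 2 ^ card A; q = 1 / 2 ^ card B; r = 1 / 2 ^ card (A \<union> B) in
      r * (exp (b + b') * cosh (M * (a + a'))) + (p - r) * (exp b * cosh (M * a))
      + (q - r) * (exp b' * cosh (M * a')) + (1 - p - q + r))"

lemma integral_exp_coin_law:
  fixes M a a' b b' :: real
  assumes M: "M > 0" and A: "A \<subseteq> {..<d}" and B: "B \<subseteq> {..<d}"
  defines "f \<equiv> \<lambda>z. exp (snd z * (a * of_bool (fst z \<in> half_box d A) + a' * of_bool (fst z \<in> half_box d B))
      + (b * of_bool (fst z \<in> half_box d A) + b' * of_bool (fst z \<in> half_box d B)))"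
  shows "integrable (coin_law d M) f" and "integral\<^sup>L (coin_law d M) f = pair_mgf M A B a a' b b'"
proof -
  let ?D = "coin_law d M" and ?C = "cube_measure d"
  interpret C: prob_space ?C by (rule prob_space_cube_measure)
  interpret Y: prob_space "sign_measure M" by (rule prob_space_sign_measure) fact
  interpret pair_prob_space ?C "sign_measure M" ..
  interpret D: prob_space ?D by (rule prob_space_coin_law) fact
  note mA = half_box_measurable[OF A] and mB = half_box_measurable[OF B]
  have AB: "half_box d A \<inter> half_box d B = half_box d (A \<union> B)" by (auto simp: half_box_def)
  have [measurable]: "(\<lambda>x. of_bool (x \<in> half_box d A) :: real) \<in> borel_measurable ?C"
    "(\<lambda>x. of_bool (x \<in> half_box d B) :: real) \<in> borel_measurable ?C"
    using mA mB by (simp_all add: of_bool_def) measurable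
  have [measurable]: "(\<lambda>y. y) \<in> borel_measurable (sign_measure M)"
    by (subst measurable_cong_sets[OF sets_sign_measure refl]) (rule measurable_restrict_space1, simp)
  have meas: "f \<in> borel_measurable ?D"
    unfolding f_def coin_law_def by measurable
  show int: "integrable ?D f"
  proof (rule D.integrable_const_bound[OF _ meas])
    have "\<bar>f z\<bar> \<le> exp (M * (\<bar>a\<bar> + \<bar>a'\<bar>) + (\<bar>b\<bar> + \<bar>b'\<bar>))" if "z \<in> space ?D" for z
    proof -
      have y: "\<bar>snd z\<bar> \<le> M" using that by (auto simp: space_coin_law)
      let ?u = "a * of_bool (fst z \<in> half_box d A) + a' * of_bool (fst z \<in> half_box d B)"
      have "snd z * ?u \<le> \<bar>snd z\<bar> * \<bar>?u\<bar>" by (metis abs_ge_self abs_mult)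
      also have "\<dots> \<le> M * (\<bar>a\<bar> + \<bar>a'\<bar>)" using y M by (intro mult_mono) auto
      finally have "snd z * ?u \<le> M * (\<bar>a\<bar> + \<bar>a'\<bar>)" .
      moreover have "b * of_bool (fst z \<in> half_box d A) + b' * of_bool (fst z \<in> half_box d B) \<le> \<bar>b\<bar> + \<bar>b'\<bar>"
        by auto
      ultimately show ?thesis unfolding f_def by simp
    qed
    then show "AE z in ?D. norm (f z) \<le> exp (M * (\<bar>a\<bar> + \<bar>a'\<bar>) + (\<bar>b\<bar> + \<bar>b'\<bar>))"
      by (intro AE_I2) simp
  qed
  define \<phi> where "\<phi> = (\<lambda>s t :: real. exp (b * s + b' * t) * cosh (M * (a * s + a' * t)))"
  have "integral\<^sup>L ?D f = (\<integral>x. \<integral>y. f (x, y) \<partial>sign_measure M \<partial>?C)"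
    using integral_fst'[of f] int unfolding coin_law_def by simp
  also have "\<dots> = (\<integral>x. \<phi> (of_bool (x \<in> half_box d A)) (of_bool (x \<in> half_box d B)) \<partial>?C)"
  proof (intro Bochner_Integration.integral_cong refl)
    have cosh: "(exp (M * u + v) + exp (- M * u + v)) / 2 = exp v * cosh (M * u)" for u v
      by (simp add: cosh_def exp_add exp_diff exp_minus field_simps)
    show "(\<integral>y. f (x, y) \<partial>sign_measure M) = \<phi> (of_bool (x \<in> half_box d A)) (of_bool (x \<in> half_box d B))" for x
      unfolding f_def \<phi>_def fst_conv snd_conv
      by (subst integral_sign_measure[OF M]) (measurable, rule cosh)
  qed
  also have "\<dots> = (\<integral>x. indicator (half_box d (A \<union> B)) x * (\<phi> 1 1 - \<phi> 1 0 - \<phi> 0 1 + \<phi> 0 0)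
      + indicator (half_box d A) x * (\<phi> 1 0 - \<phi> 0 0)
      + indicator (half_box d B) x * (\<phi> 0 1 - \<phi> 0 0) + \<phi> 0 0 \<partial>?C)"
    unfolding AB[symmetric]
    by (intro Bochner_Integration.integral_cong refl) (auto simp: indicator_def)
  also have "\<dots> = 1 / 2 ^ card (A \<union> B) * (\<phi> 1 1 - \<phi> 1 0 - \<phi> 0 1 + \<phi> 0 0)
      + 1 / 2 ^ card A * (\<phi> 1 0 - \<phi> 0 0) + 1 / 2 ^ card B * (\<phi> 0 1 - \<phi> 0 0) + \<phi> 0 0"
  proof -
    have ABs: "A \<union> B \<subseteq> {..<d}" using A B by auto
    have i: "integrable ?C (\<lambda>x. indicator (half_box d E) x * c)"
      "(\<integral>x. indicator (half_box d E) x * c \<partial>?C) = 1 / 2 ^ card E * c" if "E \<subseteq> {..<d}" for E and c :: real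
      using half_box_measurable[OF that] measure_half_box[OF that]
      by (auto simp: C.emeasure_eq_measure)
    show ?thesis
      by (simp only: Bochner_Integration.integral_add Bochner_Integration.integrable_add
          i[OF ABs] i[OF A] i[OF B] C.integrable_const lebesgue_integral_const C.prob_space scaleR_one)
  qed
  also have "\<dots> = pair_mgf M A B a a' b b'"
    unfolding pair_mgf_def \<phi>_def Let_def by (simp add: algebra_simps)
  finally show "integral\<^sup>L ?D f = pair_mgf M A B a a' b b'" .
qed

lemma pair_mgf_nonneg:
  "M > 0 \<Longrightarrow> A \<subseteq> {..<d} \<Longrightarrow> B \<subseteq> {..<d} \<Longrightarrow> 0 \<le> pair_mgf M A B a a' b b'"
  by (subst integral_exp_coin_law(2)[symmetric, of M A d B]) (simp_all add: integral_nonneg)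

text \<open>
  All exponential moments below are instances of this one: normalisation and the score bound
  use one box twice, the second moment two different boxes, and the occupancy bounds a box inside
  a larger one on its path.
\<close>

lemma expectation_exp_two_boxes:
  fixes M a a' b b' :: real and n :: nat
  assumes M: "M > 0" and A: "A \<subseteq> {..<d}" and B: "B \<subseteq> {..<d}"
  defines "F \<equiv> \<lambda>S. exp (a * vote d n S A + a' * vote d n S B + b * occupancy d n S A + b' * occupancy d n S B)"
  shows "integrable (\<Pi>\<^sub>M i\<in>{..<n}. coin_law d M) F"
    and "integral\<^sup>L (\<Pi>\<^sub>M i\<in>{..<n}. coin_law d M) F = pair_mgf M A B a a' b b' ^ n"
proof -
  interpret D: prob_space "coin_law d M" by (rule prob_space_coin_law) fact
  interpret product_sigma_finite "\<lambda>_. coin_law d M" ..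
  let ?f = "\<lambda>z. exp (snd z * (a * of_bool (fst z \<in> half_box d A) + a' * of_bool (fst z \<in> half_box d B))
      + (b * of_bool (fst z \<in> half_box d A) + b' * of_bool (fst z \<in> half_box d B)))"
  have F: "F = (\<lambda>S. \<Prod>i<n. ?f (S i))"
    unfolding F_def vote_def occupancy_def
    by (simp only: exp_sum[OF finite_lessThan, symmetric] sum_distrib_left sum.distrib[symmetric])
      (simp only: algebra_simps)
  show "integrable (\<Pi>\<^sub>M i\<in>{..<n}. coin_law d M) F"
    unfolding F by (rule product_integrable_prod) (use integral_exp_coin_law(1)[OF M A B] in auto)
  show "integral\<^sup>L (\<Pi>\<^sub>M i\<in>{..<n}. coin_law d M) F = pair_mgf M A B a a' b b' ^ n"
    unfolding F by (subst product_integral_prod)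
      (use integral_exp_coin_law[OF M A B] in auto)
qed

section \<open>Choosing one feature from each block\<close>

definition features :: "nat \<Rightarrow> (nat \<Rightarrow> nat) \<Rightarrow> nat \<Rightarrow> nat set" where
  "features q g t = (\<lambda>s. s * q + g s) ` {..<t}"

definition agreements :: "nat \<Rightarrow> (nat \<Rightarrow> nat) \<Rightarrow> (nat \<Rightarrow> nat) \<Rightarrow> nat" where
  "agreements L g h = card {t. t < L \<and> g t = h t}"

lemma block_index_inject:
  fixes q :: nat
  assumes "y < q" "z < q" "s * q + y = t * q + z"
  shows "s = t \<and> y = z"
proof -
  have "(s * q + y) div q = s" "(t * q + z) div q = t" using assms(1,2) by simp_all
  then have "s = t" using assms(3) by simp
  then show ?thesis using assms(3) by simp
qed

lemma card_features:
  assumes "g \<in> {..<L} \<rightarrow>\<^sub>E {..<q}" "t \<le> L"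
  shows "card (features q g t) = t"
proof -
  have "inj_on (\<lambda>s. s * q + g s) {..<t}"
  proof (rule inj_onI)
    fix s s' assume s: "s \<in> {..<t}" "s' \<in> {..<t}" and eq: "s * q + g s = s' * q + g s'"
    have "g s < q" "g s' < q" using assms s by (auto simp: PiE_iff)
    then show "s = s'" using block_index_inject eq by blast
  qed
  then show ?thesis by (simp add: features_def card_image)
qed

lemma features_subset:
  assumes "g \<in> {..<L} \<rightarrow>\<^sub>E {..<q}" "t \<le> L" "L * q \<le> d"
  shows "features q g t \<subseteq> {..<d}"
proof
  fix j assume "j \<in> features q g t"
  then obtain s where s: "s < t" and j: "j = s * q + g s" by (auto simp: features_def)
  have "g s < q" using assms s by (auto simp: PiE_iff)
  then have "j < Suc s * q" using j by simp
  also have "\<dots> \<le> L * q" using s assms(2) by (intro mult_le_mono1) simp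
  finally show "j \<in> {..<d}" using assms(3) by simp
qed

lemma card_features_Un:
  assumes g: "g \<in> {..<L} \<rightarrow>\<^sub>E {..<q}" and h: "h \<in> {..<L} \<rightarrow>\<^sub>E {..<q}"
  shows "card (features q g L \<union> features q h L) + agreements L g h = 2 * L"
proof -
  have lt: "g t < q" "h t < q" if "t < L" for t using g h that by (auto simp: PiE_iff)
  have "features q g L \<inter> features q h L = (\<lambda>s. s * q + g s) ` {t. t < L \<and> g t = h t}"
  proof (intro set_eqI iffI)
    fix j assume "j \<in> features q g L \<inter> features q h L"
    then obtain s t where st: "s < L" "j = s * q + g s" "t < L" "j = t * q + h t"
      by (auto simp: features_def)
    then have "s = t \<and> g s = h t" using block_index_inject[of "g s" q "h t" s t] lt by auto
    then show "j \<in> (\<lambda>s. s * q + g s) ` {t. t < L \<and> g t = h t}" using st by (intro image_eqI[of _ _ s]) auto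
  next
    fix j assume "j \<in> (\<lambda>s. s * q + g s) ` {t. t < L \<and> g t = h t}"
    then obtain s where s: "s < L" and j: "j = s * q + g s" "j = s * q + h s" by auto
    from s have "s \<in> {..<L}" by simp
    then show "j \<in> features q g L \<inter> features q h L"
      unfolding features_def using j by (intro IntI image_eqI[of j _ s])
  qed
  moreover have "inj_on (\<lambda>s. s * q + g s) {t. t < L \<and> g t = h t}"
    by (rule inj_onI) (use block_index_inject lt in blast)
  ultimately have "card (features q g L \<inter> features q h L) = agreements L g h"
    unfolding agreements_def by (simp only: card_image)
  moreover have "card (features q g L) + card (features q h L) =
      card (features q g L \<union> features q h L) + card (features q g L \<inter> features q h L)"
    by (intro card_Un_Int) (auto simp: features_def)
  ultimately show ?thesis using card_features[OF g order_refl] card_features[OF h order_refl] by simp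
qed

lemma agreements_le: "agreements L g h \<le> L"
  unfolding agreements_def using card_mono[of "{..<L}" "{t. t < L \<and> g t = h t}"] by auto

text \<open>
  The sum factorises over the blocks: in each block one choice agrees, with weight \<open>q\<close>, and
  \<open>q - 1\<close> choices disagree, with weight one.
\<close>

lemma sum_power_agreements:
  assumes q: "q \<ge> (1::nat)" and g: "g \<in> {..<L} \<rightarrow>\<^sub>E {..<q}"
  shows "(\<Sum>h\<in>{..<L} \<rightarrow>\<^sub>E {..<q}. real q ^ agreements L g h) \<le> (2 * real q) ^ L"
proof -
  have "real q ^ agreements L g h = (\<Prod>t<L. if g t = h t then real q else 1)" for h
    unfolding agreements_def by (simp add: prod.If_cases Int_def)
  then have "(\<Sum>h\<in>{..<L} \<rightarrow>\<^sub>E {..<q}. real q ^ agreements L g h)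
      = (\<Prod>t<L. \<Sum>y<q. if g t = y then real q else 1)"
    by (simp add: prod_sum_PiE)
  also have "\<dots> \<le> (\<Prod>t<L. 2 * real q)"
  proof (intro prod_mono conjI)
    fix t
    show "0 \<le> (\<Sum>y<q. if g t = y then real q else 1)" by (intro sum_nonneg) auto
    have "(\<Sum>y<q. if g t = y then real q else 1) \<le> (\<Sum>y<q. (if g t = y then real q else 0) + 1)"
      by (intro sum_mono) auto
    also have "\<dots> \<le> 2 * real q" by (simp add: sum.distrib)
    finally show "(\<Sum>y<q. if g t = y then real q else 1) \<le> 2 * real q" .
  qed
  finally show ?thesis by simp
qed

text \<open>
  Pairs agreeing in at most \<open>L - a\<close> places contribute at most \<open>exp (x / 2 ^ a)\<close> each. The other
  pairs contribute up to \<open>exp x\<close>, but are few by Markov's inequality applied to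
  \<open>q ^ agreements\<close>.
\<close>

lemma sum_exp_agreements:
  fixes x :: real and a L q :: nat
  assumes q: "q \<ge> 1" and x: "x \<ge> 0"
  defines "G \<equiv> {..<L} \<rightarrow>\<^sub>E {..<q}"
  shows "(\<Sum>g\<in>G. \<Sum>h\<in>G. exp (x * 2 ^ agreements L g h / 2 ^ L))
    \<le> (real q ^ L)\<^sup>2 * (exp (x / 2 ^ a) + exp x * 2 ^ L * real q ^ a / real q ^ L)"
proof -
  have cardG: "real (card G) = real q ^ L" by (simp add: G_def card_PiE)
  have one: "exp (x * 2 ^ s / 2 ^ L) \<le> exp (x / 2 ^ a) + exp x * real q ^ a / real q ^ L * real q ^ s"
    if "s \<le> L" for s
  proof (cases "s + a \<le> L")
    case True
    have "x * (2 ^ s * 2 ^ a) \<le> x * 2 ^ L"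
      using x True by (intro mult_left_mono) (simp_all add: power_add[symmetric])
    then have "x * 2 ^ s / 2 ^ L \<le> x / 2 ^ a" by (simp add: field_simps)
    then have "exp (x * 2 ^ s / 2 ^ L) \<le> exp (x / 2 ^ a)" by simp
    moreover have "0 \<le> exp x * real q ^ a / real q ^ L * real q ^ s" by simp
    ultimately show ?thesis by linarith
  next
    case False
    have "x * 2 ^ s \<le> x * 2 ^ L" using x that by (intro mult_left_mono) simp_all
    then have "exp (x * 2 ^ s / 2 ^ L) \<le> exp x" by (simp add: field_simps)
    also have "\<dots> \<le> exp x * (real q ^ (a + s) / real q ^ L)"
    proof -
      have "real q ^ L \<le> real q ^ (a + s)" using q False by (intro power_increasing) auto
      then have "1 \<le> real q ^ (a + s) / real q ^ L" using q by simp
      from mult_left_mono[OF this, of "exp x"] show ?thesis by simp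
    qed
    also have "\<dots> = exp x * real q ^ a / real q ^ L * real q ^ s" by (simp add: power_add)
    also have "\<dots> \<le> exp (x / 2 ^ a) + \<dots>" by simp
    finally show ?thesis .
  qed
  have "(\<Sum>g\<in>G. \<Sum>h\<in>G. exp (x * 2 ^ agreements L g h / 2 ^ L))
      \<le> (\<Sum>g\<in>G. \<Sum>h\<in>G. exp (x / 2 ^ a) + exp x * real q ^ a / real q ^ L * real q ^ agreements L g h)"
    by (intro sum_mono one agreements_le)
  also have "\<dots> = (\<Sum>g\<in>G. real q ^ L * exp (x / 2 ^ a)
      + exp x * real q ^ a / real q ^ L * (\<Sum>h\<in>G. real q ^ agreements L g h))"
    by (simp add: sum.distrib sum_distrib_left cardG)
  also have "\<dots> \<le> (\<Sum>g\<in>G. real q ^ L * exp (x / 2 ^ a)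
      + exp x * real q ^ a / real q ^ L * (2 * real q) ^ L)"
    unfolding G_def
    by (intro sum_mono add_left_mono mult_left_mono sum_power_agreements q) auto
  also have "\<dots> = (real q ^ L)\<^sup>2 * (exp (x / 2 ^ a) + exp x * 2 ^ L * real q ^ a / real q ^ L)"
    using q by (simp add: cardG power2_eq_square field_simps power_mult_distrib)
  finally show ?thesis .
qed

text \<open>
  If the occupancies along the path are within 20 percent of their expectations, the left
  child receives between one third and three quarters of its parent, inside the range from \<open>0.2\<close>
  to \<open>0.8\<close>. The worst case for the size is the sibling of the final box, with at least
  \<open>2 * 0.8 - 1.2 = 0.4\<close> times the expected number of points of a leaf.
\<close>

lemma half_box_chain_valid:
  fixes n k L q d :: nat and \<alpha> :: real
  assumes g: "g \<in> {..<L} \<rightarrow>\<^sub>E {..<q}" and Lq: "L * q \<le> d" and \<alpha>: "\<alpha> \<le> 0.2"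
    and k: "real k \<le> 0.4 * (real n / 2 ^ L)"
    and occ: "\<And>t. t \<le> L \<Longrightarrow> 0.8 * (real n / 2 ^ t) \<le> occupancy d n S (features q g t)"
      "\<And>t. t \<le> L \<Longrightarrow> occupancy d n S (features q g t) \<le> 1.2 * (real n / 2 ^ t)"
    and t: "t \<le> L"
  shows "half_box d (features q g t) \<in> valid_nodes d \<alpha> k n S"
  using t
proof (induction t)
  case 0
  have "real n / 2 ^ L \<le> real n / 1" by (intro divide_left_mono) auto
  then have "real k \<le> occupancy d n S (features q g 0)" using occ(1)[of 0] k by simp
  then show ?case
    by (auto simp: occupancy_eq_card features_def half_box_def intro: valid_nodes.root)
next
  case (Suc t)
  let ?\<nu> = "half_box d (features q g t)" and ?j = "t * q + g t"
  define l where "l = ?\<nu> \<inter> {x. x ?j \<le> 1/2}"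
  define r where "r = ?\<nu> \<inter> {x. x ?j > 1/2}"
  have j: "?j < d"
    using features_subset[OF g Suc.prems Lq] by (auto simp: features_def)
  have l_eq: "l = half_box d (features q g (Suc t))"
    by (auto simp: l_def half_box_def features_def lessThan_Suc)
  define p where "p = real n / 2 ^ Suc t"
  have p: "real n / 2 ^ t = 2 * p" by (simp add: p_def)
  have "real n / 2 ^ L \<le> p"
    unfolding p_def using Suc.prems by (intro divide_left_mono power_increasing) auto
  with k have kp: "real k \<le> 0.4 * p" by simp
  have N: "real (card (data_in n S ?\<nu>)) = real (card (data_in n S l)) + real (card (data_in n S r))"
  proof -
    have "data_in n S ?\<nu> = data_in n S l \<union> data_in n S r" "data_in n S l \<inter> data_in n S r = {}"
      by (auto simp: data_in_def l_def r_def)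
    then show ?thesis by (simp add: card_Un_disjoint finite_data_in)
  qed
  have \<nu>_occ: "1.6 * p \<le> real (card (data_in n S ?\<nu>))" "real (card (data_in n S ?\<nu>)) \<le> 2.4 * p"
    using occ[of t] Suc.prems unfolding p occupancy_eq_card by simp_all
  have l_occ: "0.8 * p \<le> real (card (data_in n S l))" "real (card (data_in n S l)) \<le> 1.2 * p"
    using occ[of "Suc t"] Suc.prems unfolding p_def occupancy_eq_card l_eq by simp_all
  have r_occ: "0.4 * p \<le> real (card (data_in n S r))"
    "0.2 * real (card (data_in n S ?\<nu>)) \<le> real (card (data_in n S r))"
    using N \<nu>_occ l_occ by linarith+
  have \<alpha>N: "\<alpha> * real (card (data_in n S ?\<nu>)) \<le> 0.2 * real (card (data_in n S ?\<nu>))"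
    using \<alpha> by (intro mult_right_mono) auto
  have p0: "0 \<le> p" by (simp add: p_def)
  have kl: "k \<le> card (data_in n S l)" and kr: "k \<le> card (data_in n S r)"
    using kp l_occ r_occ p0 by linarith+
  have \<alpha>l: "\<alpha> * real (card (data_in n S ?\<nu>)) \<le> real (card (data_in n S l))"
    using \<alpha>N \<nu>_occ l_occ p0 by linarith
  have \<alpha>r: "\<alpha> * real (card (data_in n S ?\<nu>)) \<le> real (card (data_in n S r))"
    using \<alpha>N r_occ by linarith
  have "\<forall>\<rho>\<in>{l, r}. k \<le> card (data_in n S \<rho>) \<and>
      \<alpha> * real (card (data_in n S ?\<nu>)) \<le> real (card (data_in n S \<rho>))"
    using kl kr \<alpha>l \<alpha>r by blast
  moreover have "?\<nu> \<in> valid_nodes d \<alpha> k n S" using Suc by simp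
  ultimately have "l \<in> valid_nodes d \<alpha> k n S"
    by (intro valid_nodes.child[OF _ j _ _ l_def r_def insertI1]) simp_all
  then show ?case unfolding l_eq .
qed

section \<open>Moment estimates for one and two boxes\<close>

text \<open>
  The squared normalisation absorbs everything except the points in both boxes, which have
  probability \<open>2 ^ s / 2 ^ (2 * L)\<close>. For them the excess of \<open>cosh (2 * \<theta>)\<close> over two separate
  factors is \<open>cosh (2 * \<theta>) - 1 - 2 * u = 2 * u * (1 + u)\<close>.
\<close>

lemma pair_mgf_product_bound:
  fixes M \<theta> :: real and L s :: nat
  assumes M: "M > 0" and A: "card A = L" and B: "card B = L" and AB: "card (A \<union> B) + s = 2 * L"
  defines "u \<equiv> cosh \<theta> - 1"
  shows "pair_mgf M A B (\<theta> / M) (\<theta> / M) 0 0 \<le>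
    (1 + u / 2 ^ L)\<^sup>2 * exp (2 * u * (1 + u) * 2 ^ s / (2 ^ L * 2 ^ L))"
proof -
  define p where "p = (1 / 2 ^ L :: real)"
  define r where "r = (1 / 2 ^ card (A \<union> B) :: real)"
  have u: "u \<ge> 0" unfolding u_def by (simp add: cosh_real_ge_1)
  have r: "r = 2 ^ s / (2 ^ L * 2 ^ L)"
    using AB unfolding r_def by (simp add: field_simps power_add[symmetric] mult_2)
  have c: "cosh (M * (\<theta> / M + \<theta> / M)) = 1 + 4 * u + 2 * u\<^sup>2"
  proof -
    have "M * (\<theta> / M + \<theta> / M) = 2 * \<theta>" using M by simp
    then show ?thesis by (simp only: cosh_double_cosh) (simp add: u_def power2_eq_square algebra_simps)
  qed
  have "pair_mgf M A B (\<theta> / M) (\<theta> / M) 0 0 = 1 + 2 * (p * u) + r * (2 * u * (1 + u))"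
  proof -
    have "pair_mgf M A B (\<theta> / M) (\<theta> / M) 0 0 =
        r * (1 + 4 * u + 2 * u\<^sup>2) + (p - r) * (1 + u) + (p - r) * (1 + u) + (1 - p - p + r)"
      unfolding pair_mgf_def Let_def A B p_def[symmetric] r_def[symmetric] add_0 exp_zero mult_1 c
      using M by (simp add: u_def)
    then show ?thesis by (simp add: algebra_simps power2_eq_square)
  qed
  also have "\<dots> \<le> (1 + p * u)\<^sup>2 * (1 + r * (2 * u * (1 + u)))"
  proof -
    have "1 + 2 * (p * u) \<le> (1 + p * u)\<^sup>2" by (simp add: power2_sum)
    moreover have "1 \<le> (1 + p * u)\<^sup>2" using u by (simp add: p_def)
    moreover have "0 \<le> r * (2 * u * (1 + u))" using u by (simp add: r_def)
    ultimately have "1 + 2 * (p * u) \<le> (1 + p * u)\<^sup>2"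
      "1 * (r * (2 * u * (1 + u))) \<le> (1 + p * u)\<^sup>2 * (r * (2 * u * (1 + u)))"
      by (simp_all only: mult_right_mono)
    then show ?thesis unfolding distrib_left mult_1_right mult_1_left by linarith
  qed
  also have "\<dots> \<le> (1 + p * u)\<^sup>2 * exp (r * (2 * u * (1 + u)))"
    by (intro mult_left_mono exp_ge_add_one_self) simp
  finally show ?thesis by (simp add: p_def r mult_ac)
qed

text \<open>
  A box with label mean below \<open>M * c\<close> satisfies \<open>\<theta> * S\<^sub>g \<le> \<theta> * c * N\<^sub>g\<close>, for \<open>N\<^sub>g\<close> its number of
  points, so its weight is at most \<open>exp (\<theta> * c * N\<^sub>g) / \<phi>\<close>. This is the moment bounded here.
\<close>

lemma pair_mgf_score_bound:
  fixes M \<theta> c :: real and L :: nat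
  assumes A: "card A = L" and u: "cosh \<theta> - 1 \<le> 1/20"
    and c: "exp (\<theta> * c) - cosh \<theta> \<le> - (\<theta>\<^sup>2 / 20)"
  shows "pair_mgf M A A 0 0 (\<theta> * c) 0 \<le> (1 + (cosh \<theta> - 1) / 2 ^ L) * exp (- (\<theta>\<^sup>2 / (40 * 2 ^ L)))"
proof -
  define p where "p = (1 / 2 ^ L :: real)"
  define u where "u = cosh \<theta> - 1"
  have p: "0 \<le> p" "p \<le> 1" by (simp_all add: p_def)
  have u: "0 \<le> u" "u \<le> 1/20" using u by (simp_all add: u_def cosh_real_ge_1)
  have pu: "p * u \<le> 1" using mult_mono[of p 1 u 1] p u by simp
  have "pair_mgf M A A 0 0 (\<theta> * c) 0 = 1 + p * (exp (\<theta> * c) - 1)"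
    unfolding pair_mgf_def Let_def Un_absorb A p_def[symmetric] by (simp add: algebra_simps)
  also have "\<dots> \<le> 1 + p * u - p * (\<theta>\<^sup>2 / 20)"
  proof -
    have "p * (exp (\<theta> * c) - 1) \<le> p * (u - \<theta>\<^sup>2 / 20)"
      using c p by (intro mult_left_mono) (simp_all add: u_def)
    then show ?thesis by (simp add: algebra_simps)
  qed
  also have "\<dots> \<le> (1 + p * u) * (1 + - (p * (\<theta>\<^sup>2 / 40)))"
  proof -
    have "(1 + p * u) * (p * (\<theta>\<^sup>2 / 40)) \<le> 2 * (p * (\<theta>\<^sup>2 / 40))"
      using pu p by (intro mult_right_mono) auto
    then show ?thesis by (simp add: algebra_simps)
  qed
  also have "\<dots> \<le> (1 + p * u) * exp (- (p * (\<theta>\<^sup>2 / 40)))"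
    using p u by (intro mult_left_mono exp_ge_add_one_self) auto
  finally show ?thesis by (simp add: p_def u_def mult.commute)
qed

text \<open>
  The exponential moment behind Chernoff bounds for the occupancy of a box \<open>B\<close> on the path to
  \<open>A\<close>, under the law reweighted by the weight of \<open>A\<close>. The value \<open>e\<close> is the relative occupancy
  to be excluded, from above or from below according to the sign of \<open>b\<close>.
\<close>

lemma pair_mgf_occupancy_bound:
  fixes M \<theta> b :: real and L t :: nat
  assumes M: "M > 0" and A: "card A = L" and B: "card B = t" and BA: "B \<subseteq> A"
    and t: "t \<le> L" and u: "cosh \<theta> - 1 \<le> 1/20"
    and b: "b = 1/10 \<and> e = 1.2 \<or> b = - (1/10) \<and> e = 0.8"
  shows "pair_mgf M A B (\<theta> / M) 0 0 b \<le>
    (1 + (cosh \<theta> - 1) / 2 ^ L) * exp ((b * e - 1/250) / 2 ^ t)"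
proof -
  define p where "p = (1 / 2 ^ L :: real)"
  define q where "q = (1 / 2 ^ t :: real)"
  define u where "u = cosh \<theta> - 1"
  have p: "0 \<le> p" "p \<le> q" "0 \<le> q" "q \<le> 1" using t by (simp_all add: p_def q_def frac_le)
  have u: "0 \<le> u" "u \<le> 1/20" using u by (simp_all add: u_def cosh_real_ge_1)
  have pu: "0 \<le> p * u" "p * u \<le> q * u" using p u by (auto intro: mult_right_mono)
  have "pair_mgf M A B (\<theta> / M) 0 0 b = 1 + q * (exp b - 1) + p * u * exp b"
    unfolding pair_mgf_def Let_def Un_absorb2[OF BA] A B p_def[symmetric] q_def[symmetric]
    using M by (simp add: u_def algebra_simps)
  also have "\<dots> \<le> (1 + p * u) * (1 + q * (b * e - 1/250))"
    using b
  proof (elim disjE conjE)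
    assume b: "b = 1/10" "e = 1.2"
    have e: "exp b \<le> 111/100" using exp_bound[of "1/10"] by (simp add: b power2_eq_square)
    have "q * (exp b - 1) \<le> q * (11/100)" using e p by (intro mult_left_mono) auto
    moreover have "p * u * exp b \<le> p * u * (111/100)" using e pu by (intro mult_left_mono) auto
    moreover have "p * u * (11/100) \<le> q * (1/20 * (11/100))"
      using mult_mono[of p q u "1/20"] p u by simp
    moreover have "0 \<le> p * u * (q * (b * e - 1/250))" using p pu by (simp add: b)
    moreover have "(1 + p * u) * (1 + q * (b * e - 1/250)) =
        1 + q * (b * e - 1/250) + p * u + p * u * (q * (b * e - 1/250))" by (simp add: algebra_simps)
    moreover have "q * (b * e - 1/250) = q * (116/1000)" by (simp add: b)
    ultimately show ?thesis using p by linarith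
  next
    assume b: "b = - (1/10)" "e = 0.8"
    have "exp (1/10 :: real) \<ge> 11/10" using exp_ge_add_one_self[of "1/10 :: real"] by simp
    then have e: "exp b \<le> 10/11" by (simp add: b exp_minus field_simps)
    have "q * (exp b - 1) \<le> q * (- (9/100))" using e p by (intro mult_left_mono) auto
    moreover have "p * u * exp b \<le> p * u * (10 / 11)" using e pu by (intro mult_left_mono) auto
    moreover have "- (p * u * q * (84/1000)) \<ge> - (p * u * (84/1000))"
      using pu p mult_left_le[of q "p * u"] by linarith
    moreover have "(1 + p * u) * (1 + q * (b * e - 1/250)) =
        1 - q * (84/1000) + p * u - p * u * q * (84/1000)" by (simp add: b algebra_simps)
    ultimately show ?thesis using p pu by linarith
  qed
  also have "\<dots> \<le> (1 + p * u) * exp (q * (b * e - 1/250))"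
    using pu by (intro mult_left_mono exp_ge_add_one_self) auto
  finally show ?thesis by (simp add: p_def q_def u_def)
qed

section \<open>The deviation for a fixed sample size\<close>

lemma good_box_deviation:
  fixes n k L q d :: nat and \<alpha> M c :: real
  assumes M: "M > 0" and k0: "k > 0"
    and g: "g \<in> {..<L} \<rightarrow>\<^sub>E {..<q}" and Lq: "L * q \<le> d" and \<alpha>: "\<alpha> \<le> 0.2"
    and k: "real k \<le> 0.4 * (real n / 2 ^ L)"
    and occ: "\<And>t. t \<le> L \<Longrightarrow> 0.8 * (real n / 2 ^ t) \<le> occupancy d n S (features q g t)"
      "\<And>t. t \<le> L \<Longrightarrow> occupancy d n S (features q g t) \<le> 1.2 * (real n / 2 ^ t)"
    and vote: "M * c * occupancy d n S (features q g L) \<le> vote d n S (features q g L)"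
  shows "max_deviation (coin_law d M) d \<alpha> k n S \<ge> ereal (M * c)"
proof -
  let ?\<nu> = "half_box d (features q g L)"
  have \<nu>: "?\<nu> \<in> valid_nodes d \<alpha> k n S"
    using half_box_chain_valid[OF g Lq \<alpha> k occ] by simp
  have "card (data_in n S ?\<nu>) > 0" using card_valid_node[OF \<nu>] k0 by linarith
  then have "M * c \<le> sample_mean S (data_in n S ?\<nu>)"
    using vote unfolding sample_mean_def occupancy_eq_card vote_eq_sum by (simp add: field_simps)
  then have "M * c \<le> \<bar>sample_mean S (data_in n S ?\<nu>)\<bar>" by linarith
  then show ?thesis
    using \<nu> unfolding max_deviation_ge_iff[OF k0 cond_mean_coin_law[OF M]] by blast
qed

text \<open>
  Let \<open>W\<close> be the average weight of the boxes and let \<open>V\<close> be an upper bound for the average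
  weight of the bad boxes. If every box is bad then \<open>W \<le> V\<close>, and hence
  \<open>1 \<le> 4 * (W - 1)\<^sup>2 + 2 * V\<close>, since either \<open>W \<le> 1/2\<close> or \<open>V \<ge> 1/2\<close>. Taking expectations
  bounds the probability that the deviation is small.
\<close>

proposition deviation_probability_bound:
  fixes n k L q a d :: nat and \<alpha> M \<theta> c :: real
  assumes M: "M > 0" and \<alpha>: "\<alpha> \<le> 0.2" and k0: "k > 0" and q: "q \<ge> 1" and Lq: "L * q \<le> d"
    and k: "real k \<le> 0.4 * (real n / 2 ^ L)" and \<theta>: "\<theta> > 0"
    and u20: "cosh \<theta> - 1 \<le> 1/20" and c: "exp (\<theta> * c) - cosh \<theta> \<le> - (\<theta>\<^sup>2 / 20)"
  defines "m \<equiv> real n / 2 ^ L" and "u \<equiv> cosh \<theta> - 1"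
  defines "x \<equiv> m * (2 * u * (1 + u))"
  shows "1 - 4 * (exp (x / 2 ^ a) - 1 + exp x * 2 ^ L * real q ^ a / real q ^ L)
      - 2 * (exp (- (m * \<theta>\<^sup>2 / 40)) + 2 * (real L + 1) * exp (- (m / 250)))
    \<le> \<P>(S in (\<Pi>\<^sub>M i\<in>{..<n}. coin_law d M). max_deviation (coin_law d M) d \<alpha> k n S \<ge> ereal (M * c))"
proof -
  let ?P = "\<Pi>\<^sub>M i\<in>{..<n}. coin_law d M"
  interpret P: prob_space ?P by (intro prob_space_PiM prob_space_coin_law M)
  define G where "G = {..<L} \<rightarrow>\<^sub>E {..<q}"
  have finG: "finite G" unfolding G_def by (intro finite_PiE) auto
  have cardG: "real (card G) = real q ^ L" by (simp add: G_def card_PiE)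
  have Q: "real q ^ L > 0" using q by simp
  have sub: "features q g t \<subseteq> {..<d}" if "g \<in> G" "t \<le> L" for g t
    using features_subset[OF _ that(2) Lq] that(1) by (simp add: G_def)
  have card: "card (features q g t) = t" if "g \<in> G" "t \<le> L" for g t
    using card_features that by (simp add: G_def)
  have u0: "u \<ge> 0" unfolding u_def by (simp add: cosh_real_ge_1)
  define \<phi> where "\<phi> = (1 + u / 2 ^ L) ^ n"
  have \<phi>: "\<phi> > 0" unfolding \<phi>_def using u0 by (intro zero_less_power add_pos_nonneg) auto
  have m0: "m \<ge> 0" by (simp add: m_def)

  \<comment> \<open>\<open>b\<^sub>0\<close> and \<open>b\<close> dominate the weight of a box that is bad because of its label mean, or because
     of the occupancy at depth \<open>t\<close>, respectively; \<open>B\<close> covers all these reasons.\<close>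
  define v where "v = (\<lambda>g S. vote d n S (features q g L))"
  define N where "N = (\<lambda>g t S. occupancy d n S (features q g t))"
  define w where "w = (\<lambda>g S. exp (\<theta> / M * v g S) / \<phi>)"
  define b\<^sub>0 where "b\<^sub>0 = (\<lambda>g S. exp (\<theta> * c * N g L S) / \<phi>)"
  define b where "b = (\<lambda>\<eta> e g t S. exp (\<theta> / M * v g S + \<eta> * N g t S) / \<phi> * exp (- (\<eta> * e * (real n / 2 ^ t))))"
  define B where "B = (\<lambda>g S. b\<^sub>0 g S + (\<Sum>t\<le>L. b (1/10) 1.2 g t S + b (- (1/10)) 0.8 g t S))"
  define W where "W = (\<lambda>S. (\<Sum>g\<in>G. w g S) / real q ^ L)"
  define V where "V = (\<lambda>S. (\<Sum>g\<in>G. B g S) / real q ^ L)"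

  have int_w: "integrable ?P (w g)" and exp_w: "P.expectation (w g) = 1" if g: "g \<in> G" for g
  proof -
    note E = expectation_exp_two_boxes[OF M sub[OF g order_refl] sub[OF g order_refl], of n "\<theta> / M" 0 0 0]
    have w: "w g = (\<lambda>S. exp (\<theta> / M * vote d n S (features q g L) + 0 * vote d n S (features q g L)
        + 0 * occupancy d n S (features q g L) + 0 * occupancy d n S (features q g L)) / \<phi>)"
      by (simp add: w_def v_def)
    show "integrable ?P (w g)" unfolding w by (intro integrable_divide E(1))
    have "pair_mgf M (features q g L) (features q g L) (\<theta> / M) 0 0 0 = 1 + u / 2 ^ L"
      using M by (simp add: pair_mgf_def card[OF g] u_def field_simps)
    then show "P.expectation (w g) = 1"
      unfolding w using E(2) \<phi> by (simp add: \<phi>_def[symmetric])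
  qed
  have int_ww: "integrable ?P (\<lambda>S. w g S * w h S)"
    and exp_ww: "P.expectation (\<lambda>S. w g S * w h S) \<le> exp (x * 2 ^ agreements L g h / 2 ^ L)"
    if g: "g \<in> G" and h: "h \<in> G" for g h
  proof -
    note E = expectation_exp_two_boxes[OF M sub[OF g order_refl] sub[OF h order_refl],
        of n "\<theta> / M" "\<theta> / M" 0 0]
    have ww: "(\<lambda>S. w g S * w h S) = (\<lambda>S. exp (\<theta> / M * vote d n S (features q g L)
        + \<theta> / M * vote d n S (features q h L)
        + 0 * occupancy d n S (features q g L) + 0 * occupancy d n S (features q h L)) / \<phi>\<^sup>2)"
      by (simp add: w_def v_def exp_add power2_eq_square)
    show "integrable ?P (\<lambda>S. w g S * w h S)" unfolding ww by (intro integrable_divide E(1))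
    let ?m = "pair_mgf M (features q g L) (features q h L) (\<theta> / M) (\<theta> / M) 0 0"
    let ?r = "2 * u * (1 + u) * 2 ^ agreements L g h / (2 ^ L * 2 ^ L)"
    have "?m \<le> (1 + u / 2 ^ L)\<^sup>2 * exp ?r"
      unfolding u_def using g h
      by (intro pair_mgf_product_bound[OF M card[OF g] card[OF h] card_features_Un]) (simp_all add: G_def)
    moreover have "0 \<le> ?m" by (rule pair_mgf_nonneg[OF M sub[OF g order_refl] sub[OF h order_refl]])
    ultimately have "?m ^ n \<le> ((1 + u / 2 ^ L)\<^sup>2 * exp ?r) ^ n" by (rule power_mono)
    also have "\<dots> = \<phi>\<^sup>2 * exp (real n * ?r)"
      by (simp only: \<phi>_def power_mult_distrib exp_of_nat_mult power_mult[symmetric] mult.commute[of n 2])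
    also have "real n * ?r = x * 2 ^ agreements L g h / 2 ^ L"
      by (simp add: x_def m_def)
    finally have "?m ^ n / \<phi>\<^sup>2 \<le> exp (x * 2 ^ agreements L g h / 2 ^ L)"
      using \<phi> by (simp add: field_simps)
    then show "P.expectation (\<lambda>S. w g S * w h S) \<le> exp (x * 2 ^ agreements L g h / 2 ^ L)"
      unfolding ww using E(2) by simp
  qed
  have tilted: "y ^ n / \<phi> \<le> exp (real n * z)"
    if "y \<le> (1 + u / 2 ^ L) * exp z" "0 \<le> y" for y z
  proof -
    have "y ^ n \<le> ((1 + u / 2 ^ L) * exp z) ^ n" using that by (intro power_mono)
    also have "\<dots> = \<phi> * exp (real n * z)"
      by (simp only: \<phi>_def power_mult_distrib exp_of_nat_mult)
    finally show ?thesis using \<phi> by (simp add: divide_le_eq mult.commute)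
  qed
  have int_b0: "integrable ?P (b\<^sub>0 g)"
    and exp_b0: "P.expectation (b\<^sub>0 g) \<le> exp (- (m * \<theta>\<^sup>2 / 40))" if g: "g \<in> G" for g
  proof -
    note sg = sub[OF g order_refl]
    note E = expectation_exp_two_boxes[OF M sg sg, of n 0 0 "\<theta> * c" 0]
    have b0: "b\<^sub>0 g = (\<lambda>S. exp (0 * vote d n S (features q g L) + 0 * vote d n S (features q g L)
        + \<theta> * c * occupancy d n S (features q g L) + 0 * occupancy d n S (features q g L)) / \<phi>)"
      by (simp add: b\<^sub>0_def N_def)
    show "integrable ?P (b\<^sub>0 g)" unfolding b0 by (intro integrable_divide E(1))
    have "pair_mgf M (features q g L) (features q g L) 0 0 (\<theta> * c) 0 ^ n / \<phi> \<le> exp (real n * (- (\<theta>\<^sup>2 / (40 * 2 ^ L))))"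
      using pair_mgf_score_bound[OF card[OF g order_refl] u20 c] pair_mgf_nonneg[OF M sg sg]
      by (intro tilted) (simp_all add: u_def)
    then show "P.expectation (b\<^sub>0 g) \<le> exp (- (m * \<theta>\<^sup>2 / 40))"
      unfolding b0 using E(2) by (simp add: m_def mult.commute)
  qed
  have int_b: "integrable ?P (b \<eta> e g t)"
    and exp_b: "P.expectation (b \<eta> e g t) \<le> exp (- (m / 250))"
    if g: "g \<in> G" and t: "t \<le> L" and \<eta>: "\<eta> = 1/10 \<and> e = 1.2 \<or> \<eta> = - (1/10) \<and> e = 0.8" for \<eta> e g t
  proof -
    note sg = sub[OF g order_refl] and st = sub[OF g t]
    note E = expectation_exp_two_boxes[OF M sg st, of n "\<theta> / M" 0 0 \<eta>]
    have be: "b \<eta> e g t = (\<lambda>S. exp (\<theta> / M * vote d n S (features q g L) + 0 * vote d n S (features q g t)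
        + 0 * occupancy d n S (features q g L) + \<eta> * occupancy d n S (features q g t)) / \<phi>
        * exp (- (\<eta> * e * (real n / 2 ^ t))))"
      by (simp add: b_def N_def v_def)
    show "integrable ?P (b \<eta> e g t)" unfolding be by (intro integrable_mult_left integrable_divide E(1))
    have "features q g t \<subseteq> features q g L" using t by (auto simp: features_def)
    then have "pair_mgf M (features q g L) (features q g t) (\<theta> / M) 0 0 \<eta> ^ n / \<phi>
        \<le> exp (real n * ((\<eta> * e - 1/250) / 2 ^ t))"
      using pair_mgf_occupancy_bound[OF M card[OF g order_refl] card[OF g t] _ t u20 \<eta>] pair_mgf_nonneg[OF M sg st]
      by (intro tilted) (simp_all add: u_def)
    from mult_right_mono[OF this, of "exp (- (\<eta> * e * (real n / 2 ^ t)))"]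
    have "P.expectation (b \<eta> e g t) \<le> exp (real n * ((\<eta> * e - 1/250) / 2 ^ t)) * exp (- (\<eta> * e * (real n / 2 ^ t)))"
      unfolding be using E(2) by simp
    also have "\<dots> = exp (- (real n / 2 ^ t / 250))"
      by (simp add: exp_add[symmetric] field_simps)
    also have "\<dots> \<le> exp (- (m / 250))"
    proof -
      have "m \<le> real n / 2 ^ t" unfolding m_def using t by (intro divide_left_mono power_increasing) auto
      then show ?thesis by simp
    qed
    finally show "P.expectation (b \<eta> e g t) \<le> exp (- (m / 250))" .
  qed
  have int_B: "integrable ?P (B g)"
    and exp_B: "P.expectation (B g) \<le> exp (- (m * \<theta>\<^sup>2 / 40)) + 2 * (real L + 1) * exp (- (m / 250))"
    if g: "g \<in> G" for g
  proof -
    have ip: "integrable ?P (b (1/10) 1.2 g t)" and im: "integrable ?P (b (- (1/10)) 0.8 g t)"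
      if "t \<le> L" for t using int_b[OF g that] by blast+
    have ep: "P.expectation (b (1/10) 1.2 g t) \<le> exp (- (m / 250))"
      and em: "P.expectation (b (- (1/10)) 0.8 g t) \<le> exp (- (m / 250))"
      if "t \<le> L" for t using exp_b[OF g that] by blast+
    have isum: "integrable ?P (\<lambda>S. \<Sum>t\<le>L. b (1/10) 1.2 g t S + b (- (1/10)) 0.8 g t S)"
      using ip im by (intro Bochner_Integration.integrable_sum Bochner_Integration.integrable_add) auto
    show "integrable ?P (B g)"
      unfolding B_def using isum int_b0[OF g] by (intro Bochner_Integration.integrable_add)
    have "P.expectation (B g) = P.expectation (b\<^sub>0 g)
        + (\<Sum>t\<le>L. P.expectation (b (1/10) 1.2 g t) + P.expectation (b (- (1/10)) 0.8 g t))"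
      unfolding B_def using isum int_b0[OF g] ip im
      by (simp add: Bochner_Integration.integral_add Bochner_Integration.integral_sum)
    also have "\<dots> \<le> exp (- (m * \<theta>\<^sup>2 / 40)) + (\<Sum>t\<le>L. exp (- (m / 250)) + exp (- (m / 250)))"
      using ep em exp_b0[OF g] by (intro add_mono sum_mono) auto
    finally show "P.expectation (B g) \<le> exp (- (m * \<theta>\<^sup>2 / 40)) + 2 * (real L + 1) * exp (- (m / 250))"
      by (simp add: algebra_simps)
  qed

  have int_W: "integrable ?P W" unfolding W_def
    by (intro integrable_divide Bochner_Integration.integrable_sum int_w)
  have exp_W: "P.expectation W = 1"
    unfolding W_def using Q by (simp add: int_w exp_w cardG)
  have WW: "(\<lambda>S. (W S)\<^sup>2) = (\<lambda>S. (\<Sum>g\<in>G. \<Sum>h\<in>G. w g S * w h S) / (real q ^ L)\<^sup>2)"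
    by (simp add: W_def power_divide power2_eq_square sum_product)
  have int_WW: "integrable ?P (\<lambda>S. (W S)\<^sup>2)"
    unfolding WW by (intro integrable_divide Bochner_Integration.integrable_sum int_ww)
  have exp_WW: "P.expectation (\<lambda>S. (W S)\<^sup>2) \<le> exp (x / 2 ^ a) + exp x * 2 ^ L * real q ^ a / real q ^ L"
  proof -
    have "P.expectation (\<lambda>S. (W S)\<^sup>2) = (\<Sum>g\<in>G. \<Sum>h\<in>G. P.expectation (\<lambda>S. w g S * w h S)) / (real q ^ L)\<^sup>2"
      unfolding WW by (simp add: Bochner_Integration.integral_sum Bochner_Integration.integrable_sum int_ww)
    also have "\<dots> \<le> (\<Sum>g\<in>G. \<Sum>h\<in>G. exp (x * 2 ^ agreements L g h / 2 ^ L)) / (real q ^ L)\<^sup>2"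
      by (intro divide_right_mono sum_mono exp_ww) auto
    also have "\<dots> \<le> ((real q ^ L)\<^sup>2 * (exp (x / 2 ^ a) + exp x * 2 ^ L * real q ^ a / real q ^ L)) / (real q ^ L)\<^sup>2"
      unfolding G_def using m0 u0
      by (intro divide_right_mono sum_exp_agreements q) (auto simp: x_def)
    also have "\<dots> = exp (x / 2 ^ a) + exp x * 2 ^ L * real q ^ a / real q ^ L"
      using Q by (intro nonzero_mult_div_cancel_left) simp
    finally show ?thesis .
  qed
  have int_V: "integrable ?P V" unfolding V_def
    by (intro integrable_divide Bochner_Integration.integrable_sum int_B)
  have exp_V: "P.expectation V \<le> exp (- (m * \<theta>\<^sup>2 / 40)) + 2 * (real L + 1) * exp (- (m / 250))"
    (is "_ \<le> ?v")
  proof -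
    have "P.expectation V = (\<Sum>g\<in>G. P.expectation (B g)) / real q ^ L"
      unfolding V_def by (simp add: Bochner_Integration.integral_sum int_B)
    also have "\<dots> \<le> (\<Sum>g\<in>G. ?v) / real q ^ L"
      by (intro divide_right_mono sum_mono exp_B) auto
    also have "\<dots> = ?v" using Q by (simp add: cardG)
    finally show ?thesis .
  qed

  have B_nonneg: "0 \<le> B g S" for g S
    unfolding B_def b_def b\<^sub>0_def using \<phi> by (intro add_nonneg_nonneg sum_nonneg) auto
  have bad: "w g S \<le> B g S"
    if g: "g \<in> G" and no: "\<not> max_deviation (coin_law d M) d \<alpha> k n S \<ge> ereal (M * c)" for g S
  proof -
    have sum_ge: "b \<eta> e g t S \<le> B g S"
      if t: "t \<le> L" and \<eta>: "\<eta> = 1/10 \<and> e = 1.2 \<or> \<eta> = - (1/10) \<and> e = 0.8" for \<eta> e t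
    proof -
      have bn: "0 \<le> b \<eta>' e' g t' S" for \<eta>' e' t' unfolding b_def using \<phi> by simp
      have "b \<eta> e g t S \<le> b (1/10) 1.2 g t S + b (- (1/10)) 0.8 g t S"
        using \<eta> bn[of "1/10" "1.2" t] bn[of "- (1/10)" "0.8" t]
        by (elim disjE conjE) (simp_all only: le_add_same_cancel1 le_add_same_cancel2)
      also have "\<dots> \<le> (\<Sum>t\<le>L. b (1/10) 1.2 g t S + b (- (1/10)) 0.8 g t S)"
        using t bn by (intro member_le_sum) (auto intro: add_nonneg_nonneg)
      also have "\<dots> \<le> B g S" unfolding B_def b\<^sub>0_def using \<phi> by simp
      finally show ?thesis .
    qed
    have shift: "w g S \<le> b \<eta> e g t S" if "\<eta> * e * (real n / 2 ^ t) \<le> \<eta> * N g t S" for \<eta> e t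
    proof -
      have "b \<eta> e g t S = exp (\<theta> / M * v g S + (\<eta> * N g t S - \<eta> * e * (real n / 2 ^ t))) / \<phi>"
      proof -
        have "exp (\<theta> / M * v g S + (\<eta> * N g t S - \<eta> * e * (real n / 2 ^ t)))
            = exp (\<theta> / M * v g S + \<eta> * N g t S) * exp (- (\<eta> * e * (real n / 2 ^ t)))"
          by (simp only: exp_add[symmetric] add_diff_eq add_uminus_conv_diff)
        then show ?thesis unfolding b_def by simp
      qed
      moreover have "exp (\<theta> / M * v g S) \<le> exp (\<theta> / M * v g S + (\<eta> * N g t S - \<eta> * e * (real n / 2 ^ t)))"
        using that by simp
      ultimately show ?thesis unfolding w_def using \<phi> by (simp add: divide_right_mono)
    qed
    show ?thesis
    proof (rule ccontr)
      assume neg: "\<not> ?thesis"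
      have lo: "0.8 * (real n / 2 ^ t) \<le> N g t S" if t: "t \<le> L" for t
      proof (rule ccontr)
        assume "\<not> ?thesis"
        then have "w g S \<le> b (- (1/10)) 0.8 g t S" by (intro shift) simp
        then show False using sum_ge[OF t] neg by fastforce
      qed
      have hi: "N g t S \<le> 1.2 * (real n / 2 ^ t)" if t: "t \<le> L" for t
      proof (rule ccontr)
        assume "\<not> ?thesis"
        then have "w g S \<le> b (1/10) 1.2 g t S" by (intro shift) simp
        then show False using sum_ge[OF t] neg by fastforce
      qed
      have "M * c * N g L S \<le> v g S"
      proof (rule ccontr)
        assume "\<not> ?thesis"
        then have "\<theta> / M * v g S \<le> \<theta> / M * (M * c * N g L S)"
          using \<theta> M by (intro mult_left_mono) auto
        then have "\<theta> / M * v g S \<le> \<theta> * c * N g L S" using M by simp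
        then have "w g S \<le> b\<^sub>0 g S" unfolding w_def b\<^sub>0_def using \<phi> by (simp add: divide_right_mono)
        also have "b\<^sub>0 g S \<le> B g S"
          unfolding B_def b_def using \<phi> by (simp add: sum_nonneg)
        finally show False using neg by simp
      qed
      with lo hi g no show False
        using good_box_deviation[OF M k0 _ Lq \<alpha> k, of g S c] unfolding N_def v_def G_def by blast
    qed
  qed
  have V_nonneg: "0 \<le> V S" for S
    unfolding V_def by (intro divide_nonneg_nonneg sum_nonneg B_nonneg) simp
  let ?E = "{S \<in> space ?P. max_deviation (coin_law d M) d \<alpha> k n S \<ge> ereal (M * c)}"
  have E: "?E \<in> sets ?P"
    by (rule measurable_deviation_event[OF sets_coin_law k0 cond_mean_coin_law[OF M]])
  have point: "indicator (space ?P - ?E) S \<le> 4 * (W S - 1)\<^sup>2 + 2 * V S" for S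
  proof (cases "S \<in> space ?P - ?E")
    case True
    then have "W S \<le> V S" unfolding W_def V_def by (intro divide_right_mono sum_mono bad) auto
    moreover have "1 \<le> 4 * (W S - 1)\<^sup>2" if "W S \<le> 1/2"
    proof -
      have "(1/2)\<^sup>2 \<le> (1 - W S)\<^sup>2" using that by (intro power_mono) auto
      then show ?thesis by (simp add: power2_eq_square algebra_simps)
    qed
    moreover have "0 \<le> (W S - 1)\<^sup>2" by simp
    ultimately have "1 \<le> 4 * (W S - 1)\<^sup>2 + 2 * V S" using V_nonneg[of S] by linarith
    then show ?thesis using True by simp
  next
    case False
    then show ?thesis using V_nonneg[of S] by simp
  qed
  have expand: "(\<lambda>S. 4 * (W S - 1)\<^sup>2 + 2 * V S) = (\<lambda>S. 4 * (W S)\<^sup>2 - 8 * W S + 4 + 2 * V S)"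
    by (simp add: power2_eq_square algebra_simps)
  have int: "integrable ?P (\<lambda>S. 4 * (W S - 1)\<^sup>2 + 2 * V S)"
    unfolding expand using int_W int_WW int_V by simp
  have "P.prob (space ?P - ?E) = P.expectation (indicator (space ?P - ?E))"
    by (simp add: Int_absorb2 Diff_subset)
  also have "\<dots> \<le> P.expectation (\<lambda>S. 4 * (W S - 1)\<^sup>2 + 2 * V S)"
  proof (rule integral_mono[OF _ int])
    show "integrable ?P (indicator (space ?P - ?E) :: _ \<Rightarrow> real)"
      by (rule integrable_real_indicator[OF sets.compl_sets[OF E]]) (simp add: P.emeasure_eq_measure)
  qed (rule point)
  also have "\<dots> = 4 * P.expectation (\<lambda>S. (W S)\<^sup>2) - 4 + 2 * P.expectation V"
    unfolding expand using int_W int_WW int_V exp_W by (simp add: P.prob_space)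
  finally have "P.prob (space ?P - ?E) \<le> 4 * P.expectation (\<lambda>S. (W S)\<^sup>2) - 4 + 2 * P.expectation V" .
  moreover have "1 - 4 * (e - 1 + e') - 2 * y \<le> p"
    if "p' \<le> 4 * z - 4 + 2 * y'" "p' = 1 - p" "z \<le> e + e'" "y' \<le> y" for e e' p p' y y' z :: real
    using that by argo
  ultimately show ?thesis
    using P.prob_compl[OF E] exp_WW exp_V by blast
qed

section \<open>The limit of large samples\<close>

text \<open>
  With \<open>2 ^ depth n\<close> about \<open>n powr (3/4)\<close>, the boxes keep a polynomial number of points, and
  \<open>depth n\<close> is about \<open>3 / (4 * ln 2) * ln n\<close>. The coefficient exceeds \<open>27/25\<close>, which leaves
  room above the \<open>9/10\<close> required by the second moment.
\<close>

definition depth :: "nat \<Rightarrow> nat" where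
  "depth n = nat \<lfloor>3/4 * log 2 (real n)\<rfloor>"

text \<open>
  The added one makes the leaf size positive for every \<open>n\<close>; for large \<open>n\<close> the value is still
  at most \<open>2/5\<close> of the expected box size, as \<open>half_box_chain_valid\<close> requires.
\<close>

definition leaf_size :: "nat \<Rightarrow> nat" where
  "leaf_size n = nat \<lfloor>real n / 2 ^ depth n / 3\<rfloor> + 1"

lemma depth_bounds:
  assumes "n \<ge> 1"
  shows "real (depth n) \<le> 9/8 * ln (real n)" "27/25 * ln (real n) - 1 \<le> real (depth n)"
    "real (depth n) * ln 2 \<le> ln (real n)"
    "real n powr (1/4) \<le> real n / 2 ^ depth n"
proof -
  define l where "l = ln (real n)"
  have l: "l \<ge> 0" using assms by (simp add: l_def)
  have ln2: "ln 2 \<le> (25/36 :: real)" "ln 2 \<ge> (2/3 :: real)" "ln 2 > (0 :: real)"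
    using ln2_le_25_over_36 ln2_ge_two_thirds by auto
  have log: "log 2 (real n) = l / ln 2" by (simp add: log_def l_def)
  have log0: "log 2 (real n) \<ge> 0" unfolding log using l ln2 by simp
  have D: "real (depth n) \<le> 3/4 * log 2 (real n)" "3/4 * log 2 (real n) - 1 \<le> real (depth n)"
    unfolding depth_def using log0 by linarith+
  have "l / ln 2 \<le> l * (3/2)" using ln2 l by (simp add: field_simps mult_left_mono)
  then show "real (depth n) \<le> 9/8 * ln (real n)" using D(1) unfolding log l_def by linarith
  have "l * (36/25) \<le> l / ln 2" using ln2 l by (simp add: field_simps mult_left_mono)
  then show "27/25 * ln (real n) - 1 \<le> real (depth n)" using D(2) unfolding log l_def by linarith
  have Dl: "real (depth n) * ln 2 \<le> 3/4 * l"
    using D(1) ln2(3) unfolding log by (simp add: field_simps)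
  then show "real (depth n) * ln 2 \<le> ln (real n)" using l unfolding l_def by linarith
  have "(2 :: real) ^ depth n = exp (real (depth n) * ln 2)"
    by (simp add: exp_of_nat_mult)
  also have "\<dots> \<le> exp (3/4 * l)" using Dl by simp
  finally have "(2 :: real) ^ depth n \<le> exp (3/4 * l)" .
  then have "real n powr (1/4) * 2 ^ depth n \<le> real n powr (1/4) * exp (3/4 * l)"
    by (intro mult_left_mono) simp_all
  also have "\<dots> = exp (1/4 * l + 3/4 * l)"
    unfolding exp_add using assms by (simp add: powr_def l_def)
  also have "\<dots> = real n" using assms by (simp add: l_def)
  finally have "real n powr (1/4) * 2 ^ depth n \<le> real n" .
  then show "real n powr (1/4) \<le> real n / 2 ^ depth n" by (simp add: field_simps)
qed

lemma floor_powr_bounds: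
  assumes "real n powr r \<ge> 2"
  shows "real (nat \<lfloor>real n powr r\<rfloor>) \<le> real n powr r" "real n powr r / 2 \<le> real (nat \<lfloor>real n powr r\<rfloor>)"
  using assms by linarith+

text \<open>
  For small \<open>\<theta>\<close> the target \<open>c = 2/5 * \<theta>\<close> lies below \<open>\<theta> / 2\<close>, so \<open>exp (\<theta> * c) - cosh \<theta>\<close> is
  negative of order \<open>\<theta>\<^sup>2\<close>.
\<close>

lemma eventually_cosh_bounds:
  "eventually (\<lambda>\<theta>::real. cosh \<theta> - 1 \<le> 1/20 \<and> exp (\<theta> * (2/5 * \<theta>)) - cosh \<theta> \<le> - (\<theta>\<^sup>2 / 20) \<and>
     2 * (cosh \<theta> - 1) * cosh \<theta> \<le> 6/5 * \<theta>\<^sup>2) (at_right 0)"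
proof (intro eventually_conj)
  show "eventually (\<lambda>\<theta>::real. cosh \<theta> - 1 \<le> 1/20) (at_right 0)"
    unfolding cosh_field_def by real_asymp
  show "eventually (\<lambda>\<theta>::real. exp (\<theta> * (2/5 * \<theta>)) - cosh \<theta> \<le> - (\<theta>\<^sup>2 / 20)) (at_right 0)"
    unfolding cosh_field_def by real_asymp
  show "eventually (\<lambda>\<theta>::real. 2 * (cosh \<theta> - 1) * cosh \<theta> \<le> 6/5 * \<theta>\<^sup>2) (at_right 0)"
    unfolding cosh_field_def by real_asymp
qed

text \<open>
  The cutoff between few and many agreements: cubing \<open>l = ln n\<close> beats \<open>x\<close>, which is of order
  \<open>l\<^sup>2\<close>, while the cutoff itself is only of order \<open>ln l\<close>.
\<close>

lemma log2_power_ceiling: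
  fixes l :: real
  assumes "l \<ge> 1"
  shows "l ^ 3 \<le> 2 ^ nat \<lceil>3 * log 2 l\<rceil>" "real (nat \<lceil>3 * log 2 l\<rceil>) \<le> 5 * ln l + 1"
proof -
  have ge: "3 * log 2 l \<le> real (nat \<lceil>3 * log 2 l\<rceil>)" by linarith
  have "l ^ 3 = 2 powr (3 * log 2 l)"
  proof -
    have "2 powr (log 2 l * 3) = l powr 3" unfolding powr_powr[symmetric] using assms by simp
    then show ?thesis using assms by (simp add: mult.commute)
  qed
  also have "\<dots> \<le> 2 powr real (nat \<lceil>3 * log 2 l\<rceil>)" using ge by (intro powr_mono) auto
  finally show "l ^ 3 \<le> 2 ^ nat \<lceil>3 * log 2 l\<rceil>" by (simp add: powr_realpow)
  have "3 * log 2 l \<ge> 0" using assms by simp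
  then have "real (nat \<lceil>3 * log 2 l\<rceil>) \<le> 3 * log 2 l + 1" by linarith
  also have "3 * log 2 l \<le> 5 * ln l"
  proof -
    have "3 \<le> 5 * ln (2 :: real)" using ln2_ge_two_thirds by simp
    then have "ln l * 3 \<le> ln l * (5 * ln 2)" using assms by (intro mult_left_mono) auto
    then show ?thesis by (simp add: log_def field_simps)
  qed
  finally show "real (nat \<lceil>3 * log 2 l\<rceil>) \<le> 5 * ln l + 1" by simp
qed

text \<open>
  The contribution of pairs with many agreements. On the logarithmic scale the main terms are
  \<open>9/10 * l * D\<close> from the second moment and \<open>- 27/25 * l * D\<close> from the number of choices,
  where \<open>D = ln d\<close>; everything else is of lower order. The bound is decreasing in \<open>D\<close> once \<open>l\<close> is
  large, so \<open>D\<close> may be replaced by its lower bound \<open>r * l / 2\<close>.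
\<close>

lemma coinciding_pairs_bound:
  fixes l D x :: real and L a d :: nat
  assumes x: "x \<le> 9/10 * l * D" and D: "D = ln (real d)" and d: "d > 0"
    and L: "27/25 * l - 1 \<le> real L" "real L \<le> 9/8 * l" "real L * ln 2 \<le> l" "L \<ge> 1"
    and l: "l \<ge> 1"
    and a: "real a \<le> 5 * ln l + 1" and dL: "2 * L \<le> d" and Dl: "ln (9/4 * l) \<le> D"
    and Dr: "r * l / 2 \<le> D" and neg: "- (9/50) * l + 5 * ln l + 2 \<le> 0"
  shows "exp x * 2 ^ L * real (d div L) ^ a / real (d div L) ^ L \<le>
    exp (r * l / 2 * (- (9/50) * l + 5 * ln l + 2) + l + (27/25 * l - 1) * ln (9/4 * l))"
proof -
  let ?q = "d div L"
  have q1: "?q \<ge> 1" using dL L(4) using div_greater_zero_iff[of d L] dL L(4) by linarith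
  have qd: "?q \<le> d" by simp
  have lnq: "ln (real ?q) \<le> D" unfolding D using q1 qd d by (subst ln_le_cancel_iff) linarith+
  have D0: "D \<ge> 0" unfolding D using d by simp
  have "real d / (2 * real L) \<le> real ?q"
  proof -
    have "real d < real (L + L * ?q)"
      using L(4) by (subst of_nat_less_iff) (rule dividend_less_times_div, simp)
    then have "real d / real L - 1 \<le> real ?q" using L(4) by (simp add: field_simps)
    moreover have "1 \<le> real d / (2 * real L)" using dL L(4) by (simp add: field_simps)
    moreover have "real d / real L = 2 * (real d / (2 * real L))" using L(4) by simp
    ultimately show ?thesis by linarith
  qed
  then have "ln (real d / (2 * real L)) \<le> ln (real ?q)" using q1 d L(4) by simp
  then have "D - ln (2 * real L) \<le> ln (real ?q)" using d L(4) by (simp add: D ln_div)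
  moreover have "ln (2 * real L) \<le> ln (9/4 * l)" using L l by simp
  ultimately have lnq': "D - ln (9/4 * l) \<le> ln (real ?q)" by linarith
  have "exp x * 2 ^ L * real ?q ^ a / real ?q ^ L
      = exp (x + real L * ln 2 + real a * ln (real ?q) - real L * ln (real ?q))"
    using q1 by (simp add: exp_add exp_diff exp_of_nat_mult)
  also have "\<dots> \<le> exp (r * l / 2 * (- (9/50) * l + 5 * ln l + 2) + l + (27/25 * l - 1) * ln (9/4 * l))"
  proof (subst exp_le_cancel_iff)
    have "real a * ln (real ?q) \<le> (5 * ln l + 1) * D"
      using a lnq q1 l by (intro mult_mono) auto
    moreover have "(27/25 * l - 1) * (D - ln (9/4 * l)) \<le> real L * ln (real ?q)"
      using L lnq' Dl by (intro mult_mono) auto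
    moreover have "D * (- (9/50) * l + 5 * ln l + 2) \<le> r * l / 2 * (- (9/50) * l + 5 * ln l + 2)"
      using Dr neg by (intro mult_right_mono_neg)
    moreover have "(5 * ln l + 1) * D = 5 * (ln l * D) + D"
      "(27/25 * l - 1) * (D - ln (9/4 * l)) = 27/25 * (l * D) - D - (27/25 * l - 1) * ln (9/4 * l)"
      "D * (- (9/50) * l + 5 * ln l + 2) = - (9/50) * (l * D) + 5 * (ln l * D) + 2 * D"
      "9/10 * l * D = 9/10 * (l * D)"
      by (simp_all add: field_simps)
    ultimately show "x + real L * ln 2 + real a * ln (real ?q) - real L * ln (real ?q)
        \<le> r * l / 2 * (- (9/50) * l + 5 * ln l + 2) + l + (27/25 * l - 1) * ln (9/4 * l)"
      using x L(3) by argo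
  qed
  finally show ?thesis .
qed

lemma leaf_size_bounds:
  assumes "real n / 2 ^ depth n \<ge> 15"
  shows "real n / 2 ^ depth n / 3 \<le> real (leaf_size n)" "real (leaf_size n) \<le> 2/5 * (real n / 2 ^ depth n)"
proof -
  define m where "m = real n / 2 ^ depth n"
  have "m / 3 \<le> real (nat \<lfloor>m / 3\<rfloor> + 1)" "real (nat \<lfloor>m / 3\<rfloor> + 1) \<le> m / 3 + 1"
    using assms unfolding m_def[symmetric] by linarith+
  then show "real n / 2 ^ depth n / 3 \<le> real (leaf_size n)" "real (leaf_size n) \<le> 2/5 * (real n / 2 ^ depth n)"
    using assms unfolding m_def[symmetric] leaf_size_def by linarith+
qed

lemma leaf_size_pos: "leaf_size n > 0"
  by (simp add: leaf_size_def)

lemma leaf_size_lower: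
  assumes "n \<ge> 1"
  shows "real n powr (1/4) / 3 \<le> real (leaf_size n)"
proof -
  have "real n powr (1/4) / 3 \<le> real n / 2 ^ depth n / 3"
    using depth_bounds(4)[OF assms] by (rule divide_right_mono) simp
  also have "\<dots> \<le> real (leaf_size n)" unfolding leaf_size_def by linarith
  finally show ?thesis .
qed

lemma ln_dimension_bounds:
  assumes r: "r > 0" and n: "n \<ge> 1" and d: "d = nat \<lfloor>real n powr r\<rfloor>" and large: "real n powr r \<ge> 2"
  shows "ln (real d) \<le> r * ln (real n)" "r * ln (real n) - ln 2 \<le> ln (real d)" "d > 0"
proof -
  note fl = floor_powr_bounds[OF large, folded d]
  show d0: "d > 0" using fl(2) large by (cases d) auto
  have "ln (real d) \<le> ln (real n powr r)" using fl(1) d0 n by (subst ln_le_cancel_iff) auto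
  then show "ln (real d) \<le> r * ln (real n)" using n by (simp add: ln_powr)
  have "ln (real n powr r / 2) \<le> ln (real d)" using fl(2) d0 n by (subst ln_le_cancel_iff) auto
  then show "r * ln (real n) - ln 2 \<le> ln (real d)" using n by (simp add: ln_div ln_powr)
qed

lemma tilt_filterlim:
  fixes r :: real
  assumes r: "r > 0" and d: "\<And>n. d n = nat \<lfloor>real n powr r\<rfloor>"
  shows "filterlim (\<lambda>n. sqrt (ln (real n) * ln (real (d n)) / real (leaf_size n)) / 2) (at_right 0) sequentially"
proof (rule tendsto_imp_filterlim_at_right)
  have ev: "eventually (\<lambda>n::nat. n \<ge> 1 \<and> real n powr r \<ge> 2 \<and> ln (real n) \<ge> 1 \<and> r * ln (real n) - ln 2 > 0) sequentially"
    using r by (intro eventually_conj eventually_ge_at_top; real_asymp)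
  show "eventually (\<lambda>n. sqrt (ln (real n) * ln (real (d n)) / real (leaf_size n)) / 2 > 0) sequentially"
    using ev
  proof eventually_elim
    case (elim n)
    have "ln (real (d n)) > 0" using ln_dimension_bounds(2)[OF r _ d[of n]] elim by linarith
    moreover have "real (leaf_size n) > 0" using leaf_size_pos by simp
    ultimately have "ln (real n) * ln (real (d n)) / real (leaf_size n) > 0"
      using elim by (intro divide_pos_pos mult_pos_pos) linarith+
    then show ?case by simp
  qed
  show "(\<lambda>n. sqrt (ln (real n) * ln (real (d n)) / real (leaf_size n)) / 2) \<longlonglongrightarrow> 0"
  proof (rule tendsto_sandwich)
    show "eventually (\<lambda>n. 0 \<le> sqrt (ln (real n) * ln (real (d n)) / real (leaf_size n)) / 2) sequentially"
      using ev
    proof eventually_elim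
      case (elim n)
      have "ln (real (d n)) \<ge> 0" using ln_dimension_bounds(2)[OF r _ d[of n]] elim by linarith
      then show ?case using elim by simp
    qed
    show "eventually (\<lambda>n. sqrt (ln (real n) * ln (real (d n)) / real (leaf_size n)) / 2
        \<le> sqrt (ln (real n) * (r * ln (real n)) / (real n powr (1/4) / 3)) / 2) sequentially"
      using ev
    proof eventually_elim
      case (elim n)
      have "ln (real (d n)) \<le> r * ln (real n)" using ln_dimension_bounds(1)[OF r _ d[of n]] elim by blast
      then show ?case
        using leaf_size_lower[of n] elim r
        by (intro divide_right_mono real_sqrt_le_mono frac_le mult_left_mono) auto
    qed
    show "(\<lambda>n::nat. sqrt (ln (real n) * (r * ln (real n)) / (real n powr (1/4) / 3)) / 2) \<longlonglongrightarrow> 0"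
      using r by real_asymp
  qed simp
qed

text \<open>
  The tilt is \<open>\<theta> = sqrt (ln n * ln d / k) / 2\<close>, so that the target \<open>M / 5 * sqrt (ln n * ln d / k)\<close>
  is \<open>M * c\<close> for \<open>c = 2/5 * \<theta>\<close>. All error terms are replaced by functions of \<open>n\<close> alone.
\<close>

proposition deviation_probability_tendsto_1:
  fixes M r \<alpha> :: real
  assumes M: "M > 0" and r: "r > 0" and \<alpha>: "\<alpha> \<le> 0.2" and d: "\<And>n. d n = nat \<lfloor>real n powr r\<rfloor>"
  shows "(\<lambda>n. \<P>(S in (\<Pi>\<^sub>M i\<in>{..<n}. coin_law (d n) M).
      max_deviation (coin_law (d n) M) (d n) \<alpha> (leaf_size n) n S
        \<ge> ereal (M / 5 * sqrt (ln (real n) * ln (real (d n)) / real (leaf_size n))))) \<longlonglongrightarrow> 1"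
    (is "?p \<longlonglongrightarrow> 1")
proof (rule tendsto_sandwich)
  define \<theta> where "\<theta> = (\<lambda>n. sqrt (ln (real n) * ln (real (d n)) / real (leaf_size n)) / 2)"
  define gap where "gap = (\<lambda>n. let l = ln (real n) in
      4 * (exp (9/10 * r / l) - 1
        + exp (r * l / 2 * (- (9/50) * l + 5 * ln l + 2) + l + (27/25 * l - 1) * ln (9/4 * l)))
      + 2 * (exp (- (l * (r * l / 2) / 64)) + 2 * (9/8 * l + 1) * exp (- (real n powr (1/4) / 250))))"
  have tilt: "eventually (\<lambda>n. \<theta> n > 0 \<and> cosh (\<theta> n) - 1 \<le> 1/20 \<and>
      exp (\<theta> n * (2/5 * \<theta> n)) - cosh (\<theta> n) \<le> - ((\<theta> n)\<^sup>2 / 20) \<and>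
      2 * (cosh (\<theta> n) - 1) * cosh (\<theta> n) \<le> 6/5 * (\<theta> n)\<^sup>2) sequentially"
    unfolding \<theta>_def
    by (intro eventually_compose_filterlim[OF _ tilt_filterlim[OF r d]] eventually_conj
        eventually_cosh_bounds) (simp add: eventually_at_right_less)
  have large: "eventually (\<lambda>n::nat. n \<ge> 1 \<and> real n powr r \<ge> 2 \<and> ln (real n) \<ge> 2 \<and> real n powr (1/4) \<ge> 15 \<and>
      2 * (9/8 * ln (real n)) \<le> real n powr r / 2 \<and>
      ln (9/4 * ln (real n)) \<le> r * ln (real n) - ln 2 \<and>
      r * ln (real n) / 2 \<le> r * ln (real n) - ln 2 \<and>
      - (9/50) * ln (real n) + 5 * ln (ln (real n)) + 2 \<le> 0) sequentially"
    using r by (intro eventually_conj eventually_ge_at_top; real_asymp)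
  show "eventually (\<lambda>n. 1 - gap n \<le> ?p n) sequentially"
    using tilt large
  proof eventually_elim
    case (elim n)
    define l where "l = ln (real n)"
    define D where "D = ln (real (d n))"
    define L where "L = depth n"
    define m where "m = real n / 2 ^ L"
    define k where "k = leaf_size n"
    define a where "a = nat \<lceil>3 * log 2 l\<rceil>"
    define u where "u = cosh (\<theta> n) - 1"
    define x where "x = m * (2 * u * (1 + u))"
    have n: "n \<ge> 1" and large: "real n powr r \<ge> 2" and l: "l \<ge> 2" and n4: "real n powr (1/4) \<ge> 15"
      and dl: "2 * (9/8 * l) \<le> real n powr r / 2" and lnl: "ln (9/4 * l) \<le> r * l - ln 2"
      and rl: "r * l / 2 \<le> r * l - ln 2" and neg: "- (9/50) * l + 5 * ln l + 2 \<le> 0"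
      using elim(2) unfolding l_def by blast+
    have \<theta>0: "\<theta> n > 0" and u20: "cosh (\<theta> n) - 1 \<le> 1/20"
      and gain: "exp (\<theta> n * (2/5 * \<theta> n)) - cosh (\<theta> n) \<le> - ((\<theta> n)\<^sup>2 / 20)"
      and u\<theta>: "2 * (cosh (\<theta> n) - 1) * cosh (\<theta> n) \<le> 6/5 * (\<theta> n)\<^sup>2"
      using elim(1) by blast+
    note Lb = depth_bounds[OF n, folded L_def, folded l_def, folded m_def]
    have "real L > 0" using Lb(2) l by linarith
    then have L1: "L \<ge> 1" by simp
    have m15: "m \<ge> 15" using Lb(4) n4 by linarith
    have kb: "m / 3 \<le> real k" "real k \<le> 2/5 * m"
      using leaf_size_bounds[of n] m15 unfolding k_def m_def L_def by simp_all
    have k0: "k > 0" unfolding k_def by (rule leaf_size_pos)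
    note Db = ln_dimension_bounds[OF r n d large, folded l_def D_def]
    have Dr: "r * l / 2 \<le> D" using rl Db(2) by linarith
    have "r * l / 2 > 0" using r l by simp
    with Dr have D0: "D > 0" by linarith
    have dL: "2 * L \<le> d n"
    proof -
      have "real (2 * L) \<le> 2 * (9/8 * l)" using Lb(1) by simp
      also have "\<dots> \<le> real n powr r / 2" by (rule dl)
      also have "\<dots> \<le> real (d n)" using floor_powr_bounds(2)[OF large] d by simp
      finally show ?thesis by linarith
    qed
    have q1: "d n div L \<ge> 1" using div_greater_zero_iff[of "d n" L] dL L1 by linarith
    have Lq: "L * (d n div L) \<le> d n" by simp
    have lD: "l * D > 0" using l D0 by simp
    have \<theta>2: "(\<theta> n)\<^sup>2 = l * D / (4 * real k)"
      using lD by (simp add: \<theta>_def l_def[symmetric] D_def[symmetric] k_def[symmetric] power_divide)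
    have mk: "m / real k \<le> 3" "5/2 \<le> m / real k" using kb k0 by (simp_all add: field_simps)
    have x0: "x \<ge> 0" using m15 by (simp add: x_def u_def cosh_real_ge_1)
    have x_le: "x \<le> 9/10 * l * D"
    proof -
      have "x \<le> m * (6/5 * (\<theta> n)\<^sup>2)"
        using u\<theta> m15 unfolding x_def u_def by (intro mult_left_mono) simp_all
      also have "\<dots> = 3/10 * (m / real k) * (l * D)" by (simp add: \<theta>2)
      also have "\<dots> \<le> 3/10 * 3 * (l * D)" using mk lD by (intro mult_right_mono) simp_all
      finally show ?thesis by simp
    qed
    note ab = log2_power_ceiling[of l, folded a_def]
    have x_a: "x / 2 ^ a \<le> 9/10 * r / l"
    proof -
      have "x \<le> 9/10 * l * (r * l)" using x_le mult_left_mono[OF Db(1), of "9/10 * l"] l by linarith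
      then have "x / 2 ^ a \<le> 9/10 * l * (r * l) / l ^ 3"
        using ab(1) l r by (intro frac_le) auto
      also have "\<dots> = 9/10 * r / l" using l by (simp add: field_simps power3_eq_cube)
      finally show ?thesis .
    qed
    have pairs: "exp x * 2 ^ L * real (d n div L) ^ a / real (d n div L) ^ L \<le>
        exp (r * l / 2 * (- (9/50) * l + 5 * ln l + 2) + l + (27/25 * l - 1) * ln (9/4 * l))"
      by (rule coinciding_pairs_bound[OF x_le D_def Db(3) Lb(2,1,3) L1 _ _ dL _ Dr neg])
        (use l ab(2) lnl Db(2) in linarith)+
    have score: "exp (- (m * (\<theta> n)\<^sup>2 / 40)) \<le> exp (- (l * (r * l / 2) / 64))"
    proof -
      have "l * (r * l / 2) \<le> l * D" using Dr l by (intro mult_left_mono) auto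
      moreover have "5/2 * (l * D) \<le> m / real k * (l * D)" using mk lD by (intro mult_right_mono) auto
      moreover have "m * (\<theta> n)\<^sup>2 / 40 = m / real k * (l * D) / 160" by (simp add: \<theta>2)
      moreover have "s / 64 \<le> z" if "s \<le> t" "5/2 * t \<le> y" "z = y / 160" for s t y z :: real
        using that by argo
      ultimately have "l * (r * l / 2) / 64 \<le> m * (\<theta> n)\<^sup>2 / 40" by blast
      then show ?thesis by simp
    qed
    have occ: "2 * (real L + 1) * exp (- (m / 250)) \<le> 2 * (9/8 * l + 1) * exp (- (real n powr (1/4) / 250))"
      using Lb(1,4) l by (intro mult_mono) auto
    have k': "real k \<le> 0.4 * (real n / 2 ^ L)" using kb(2) by (simp add: m_def)
    have "1 - gap n \<le> 1 - 4 * (exp (x / 2 ^ a) - 1 + exp x * 2 ^ L * real (d n div L) ^ a / real (d n div L) ^ L)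
        - 2 * (exp (- (m * (\<theta> n)\<^sup>2 / 40)) + 2 * (real L + 1) * exp (- (m / 250)))"
    proof -
      have "1 - (4 * (e1 - 1 + e2) + 2 * (e3 + e4)) \<le> 1 - 4 * (f1 - 1 + f2) - 2 * (f3 + f4)"
        if "f1 \<le> e1" "f2 \<le> e2" "f3 \<le> e3" "f4 \<le> e4" for e1 e2 e3 e4 f1 f2 f3 f4 :: real
        using that by argo
      from this[OF _ pairs score occ, of "exp (x / 2 ^ a)" "exp (9/10 * r / l)"] show ?thesis
        using x_a unfolding gap_def Let_def l_def[symmetric] by simp
    qed
    also have "\<dots> \<le> \<P>(S in (\<Pi>\<^sub>M i\<in>{..<n}. coin_law (d n) M).
        max_deviation (coin_law (d n) M) (d n) \<alpha> k n S \<ge> ereal (M * (2/5 * \<theta> n)))"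
      unfolding x_def u_def m_def
      by (rule deviation_probability_bound[OF M \<alpha> k0 q1 Lq k'[unfolded L_def[symmetric]] \<theta>0 u20 gain])
    also have "M * (2/5 * \<theta> n) = M / 5 * sqrt (ln (real n) * ln (real (d n)) / real (leaf_size n))"
      by (simp add: \<theta>_def)
    finally show ?case unfolding k_def .
  qed
  show "eventually (\<lambda>n. ?p n \<le> 1) sequentially"
  proof (intro always_eventually allI)
    fix n
    interpret prob_space "\<Pi>\<^sub>M i\<in>{..<n}. coin_law (d n) M"
      by (intro prob_space_PiM prob_space_coin_law M)
    show "?p n \<le> 1" by simp
  qed
  have "gap \<longlonglongrightarrow> 0"
    unfolding gap_def Let_def using r by real_asymp
  then show "(\<lambda>n. 1 - gap n) \<longlonglongrightarrow> 1"
    using tendsto_diff[OF tendsto_const[of 1], of gap 0 sequentially] by simp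
qed simp

lemma leaf_size_dominates_logs:
  fixes r :: real
  assumes r: "r > 0" and d: "\<And>n. d n = nat \<lfloor>real n powr r\<rfloor>"
  shows "(\<lambda>n. ln (real n) * max (ln (real (d n))) (ln (ln (real n))) / real (leaf_size n)) \<longlonglongrightarrow> 0"
proof (rule tendsto_sandwich)
  have ev: "eventually (\<lambda>n::nat. n \<ge> 1 \<and> real n powr r \<ge> 2 \<and> ln (real n) \<ge> 1 \<and> ln (ln (real n)) \<ge> 0) sequentially"
    using r by (intro eventually_conj eventually_ge_at_top; real_asymp)
  show "eventually (\<lambda>n. 0 \<le> ln (real n) * max (ln (real (d n))) (ln (ln (real n))) / real (leaf_size n)) sequentially"
    using ev
  proof eventually_elim
    case (elim n)
    then show ?case by (intro divide_nonneg_nonneg mult_nonneg_nonneg) (simp_all add: le_max_iff_disj)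
  qed
  show "eventually (\<lambda>n. ln (real n) * max (ln (real (d n))) (ln (ln (real n))) / real (leaf_size n)
      \<le> ln (real n) * (r * ln (real n) + ln (ln (real n))) / (real n powr (1/4) / 3)) sequentially"
    using ev
  proof eventually_elim
    case (elim n)
    have "ln (real (d n)) \<le> r * ln (real n)" using ln_dimension_bounds(1)[OF r _ d[of n]] elim by blast
    moreover have "0 \<le> r * ln (real n)" using r elim by simp
    ultimately have "max (ln (real (d n))) (ln (ln (real n))) \<le> r * ln (real n) + ln (ln (real n))"
      using elim by simp
    then show ?case
      using leaf_size_lower[of n] elim r by (intro frac_le mult_left_mono mult_nonneg_nonneg) auto
  qed
  show "(\<lambda>n::nat. ln (real n) * (r * ln (real n) + ln (ln (real n))) / (real n powr (1/4) / 3)) \<longlonglongrightarrow> 0"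
    using r by real_asymp
qed simp

theorem theorem15:
  fixes M r \<alpha> :: real and d :: "nat \<Rightarrow> nat"
  assumes "M > 0" and "r > 0" and "0 < \<alpha>" and "\<alpha> \<le> 0.2"
    and "\<And>n. d n = nat \<lfloor>real n powr r\<rfloor>"
  shows "\<exists>(D :: nat \<Rightarrow> ((nat \<Rightarrow> real) \<times> real) measure) (k :: nat \<Rightarrow> nat).
    (\<forall>n. prob_space (D n) \<and>
         sets (D n) = sets (cube_measure (d n) \<Otimes>\<^sub>M restrict_space borel {-M..M})) \<and>
    (\<exists>\<zeta>::real. \<zeta> \<ge> 1 \<and>
       (\<forall>n. \<exists>f :: (nat \<Rightarrow> real) \<Rightarrow> real.
          distributed (D n) (cube_measure (d n)) fst (\<lambda>x. ennreal (f x)) \<and>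
          (\<forall>x\<in>unit_cube (d n). inverse \<zeta> \<le> f x \<and> f x \<le> \<zeta>))) \<and>
    (\<forall>n. k n > 0) \<and>
    (\<lambda>n. ln (real n) * max (ln (real (d n))) (ln (ln (real n))) / real (k n)) \<longlonglongrightarrow> 0 \<and>
    (\<lambda>n. \<P>(S in (\<Pi>\<^sub>M i\<in>{..<n}. D n).
       max_deviation (D n) (d n) \<alpha> (k n) n S
         \<ge> ereal (M / 5 * sqrt (ln (real n) * ln (real (d n)) / real (k n))))) \<longlonglongrightarrow> 1"
proof (intro exI[of _ "\<lambda>n. coin_law (d n) M"] exI[of _ leaf_size] conjI allI)
  show "prob_space (coin_law (d n) M)"
    "sets (coin_law (d n) M) = sets (cube_measure (d n) \<Otimes>\<^sub>M restrict_space borel {-M..M})" for n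
    using assms(1) by (simp_all only: prob_space_coin_law sets_coin_law)
  show "\<exists>\<zeta>::real. \<zeta> \<ge> 1 \<and>
      (\<forall>n. \<exists>f :: (nat \<Rightarrow> real) \<Rightarrow> real.
        distributed (coin_law (d n) M) (cube_measure (d n)) fst (\<lambda>x. ennreal (f x)) \<and>
        (\<forall>x\<in>unit_cube (d n). inverse \<zeta> \<le> f x \<and> f x \<le> \<zeta>))"
    using distributed_fst_coin_law[OF assms(1)]
    by (intro exI[of _ 1] conjI allI exI[of _ "\<lambda>_. 1"]) simp_all
  show "leaf_size n > 0" for n by (rule leaf_size_pos)
qed (use assms leaf_size_dominates_logs deviation_probability_tendsto_1 in blast)+

end
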